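(* Let $m\in\{2,3,\dots\}$. There exists an algebraic number $\alpha_m>\frac{2}{m}$ such that for every real $\alpha\geq\alpha_m$ the cone $$\mathcal{C}^\alpha_m=\left\{(x,y)\in\mathbb{R}^m\times\mathbb{R}_{\geq0} : 0\leq y\leq \sqrt{\frac{\alpha}{m-1}}\cdot|x|\right\}$$ is a local $\alpha$-perimeter minimizer in $\mathbb{R}^m\times\mathbb{R}_{\geq0}$.
   Context: Points of $\mathbb{R}^m\times\mathbb{R}_{\geq0}$ are written $z=(x,y)$ with $x\in\mathbb{R}^m$, $y\geq0$. Let $\alpha>0$ and let $\Omega\subseteq\mathbb{R}^m\times\mathbb{R}_{\geq0}$ be open with respect to the induced topology (all open sets below are open in the induced topology). For $f\in L_1(\Omega)$ put $$\int_\Omega y^\alpha|Df|:=\sup\left\{\int_\Omega f(z)\operatorname{div}(\psi(z))\,dz : \psi\in C^1_c(\Omega,\mathbb{R}^{m+1}),\ |\psi(z)|\leq y^\alpha\right\},$$ and write $f\in BV^\alpha(\Omega)$ if $f\in L_1(\Omega)$ and this quantity is finite. For a Lebesgue measurable set $E\subseteq\mathbb{R}^m\times\mathbb{R}_{\geq0}$ the $\alpha$-perimeter of $E$ in $\Omega$ is $\mathcal{P}_\alpha(E;\Omega):=\int_\Omega y^\alpha|D\chi_E|$ (the supremum above with $f=\chi_E$, possibly $+\infty$), where $\chi_E$ is the characteristic function of $E$. The set $E$ is called an $\alpha$-Caccioppoli set in $\Omega$ if it has locally finite $\alpha$-perimeter in $\Omega$, i.e. $\chi_E\in BV^\alpha_{loc}(\Omega)$.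 An $\alpha$-Caccioppoli set $E$ in $\Omega$ is called a local $\alpha$-perimeter minimizer in $\Omega$ if for all bounded open sets $B\subseteq\Omega$ we have $\mathcal{P}_\alpha(E;B)\leq\mathcal{P}_\alpha(F;B)$ for all (Lebesgue measurable) $F$ such that $F\bigtriangleup E\subset\subset B$, where $\bigtriangleup$ denotes symmetric difference and $A\subset\subset B$ means that the closure of $A$ is compact and contained in $B$. *)

theory Defs
  imports "HOL-Analysis.Analysis" "HOL-Computational_Algebra.Polynomial"
begin

definition halfspace :: "((real ^ 'm) \<times> real) set" where
  "halfspace = UNIV \<times> {0..}"

definition compactly_contained :: "'a::topological_space set \<Rightarrow> 'a set \<Rightarrow> bool" where
  "compactly_contained A B \<longleftrightarrow> compact (closure A) \<and> closure A \<subseteq> B"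

text \<open>
  The domains below are relatively open in the half-space, so they may contain boundary points
  with $y = 0$. Derivatives are therefore taken within the domain, i.e. one-sidedly at such
  points; the derivative within a relatively open subset of the half-space is unique.
\<close>

definition C1c_fields :: "'a::euclidean_space set \<Rightarrow> ('a \<Rightarrow> 'a) set" where
  "C1c_fields \<Omega> = {\<psi>. \<psi> differentiable_on \<Omega> \<and>
     (\<forall>v. continuous_on \<Omega> (\<lambda>z. frechet_derivative \<psi> (at z within \<Omega>) v)) \<and>
     compactly_contained {z \<in> \<Omega>. \<psi> z \<noteq> 0} \<Omega>}"

definition divergence :: "'a::euclidean_space set \<Rightarrow> ('a \<Rightarrow> 'a) \<Rightarrow> 'a \<Rightarrow> real" where
  "divergence \<Omega> \<psi> z = (\<Sum>b\<in>Basis. frechet_derivative \<psi> (at z within \<Omega>) b \<bullet> b)"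

text \<open>
  Since \<open>0 powr \<alpha> = 0\<close>, admissible fields vanish where $y = 0$. The value is meaningful for
  measurable \<open>f\<close> that is integrable on compact subsets of \<open>\<Omega>\<close>; otherwise the Bochner integrals may
  default to 0. In particular it covers every bounded measurable \<open>f\<close>, such as indicators.
\<close>

definition weighted_variation ::
    "real \<Rightarrow> ((real ^ 'm) \<times> real) set \<Rightarrow> ((real ^ 'm) \<times> real \<Rightarrow> real) \<Rightarrow> ereal" where
  "weighted_variation \<alpha> \<Omega> f =
     (SUP \<psi> \<in> {\<psi> \<in> C1c_fields \<Omega>. \<forall>z\<in>\<Omega>. norm (\<psi> z) \<le> snd z powr \<alpha>}.
        ereal (LINT z:\<Omega>|lebesgue. f z * divergence \<Omega> \<psi> z))"

definition BV :: "real \<Rightarrow> ((real ^ 'm) \<times> real) set \<Rightarrow> ((real ^ 'm) \<times> real \<Rightarrow> real) set" where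
  "BV \<alpha> \<Omega> = {f. set_integrable lebesgue \<Omega> f \<and> weighted_variation \<alpha> \<Omega> f < \<infinity>}"

definition BV_loc ::
    "real \<Rightarrow> ((real ^ 'm) \<times> real) set \<Rightarrow> ((real ^ 'm) \<times> real \<Rightarrow> real) set" where
  "BV_loc \<alpha> \<Omega> = {f. \<forall>U. openin (top_of_set halfspace) U \<and> compactly_contained U \<Omega> \<longrightarrow> f \<in> BV \<alpha> U}"

definition perimeter ::
    "real \<Rightarrow> ((real ^ 'm) \<times> real) set \<Rightarrow> ((real ^ 'm) \<times> real) set \<Rightarrow> ereal" where
  "perimeter \<alpha> E \<Omega> = weighted_variation \<alpha> \<Omega> (indicator E)"

definition caccioppoli ::
    "real \<Rightarrow> ((real ^ 'm) \<times> real) set \<Rightarrow> ((real ^ 'm) \<times> real) set \<Rightarrow> bool" where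
  "caccioppoli \<alpha> E \<Omega> \<longleftrightarrow>
     E \<in> sets lebesgue \<and> E \<subseteq> halfspace \<and> indicator E \<in> BV_loc \<alpha> \<Omega>"

definition local_perimeter_minimizer ::
    "real \<Rightarrow> ((real ^ 'm) \<times> real) set \<Rightarrow> ((real ^ 'm) \<times> real) set \<Rightarrow> bool" where
  "local_perimeter_minimizer \<alpha> E \<Omega> \<longleftrightarrow> caccioppoli \<alpha> E \<Omega> \<and>
     (\<forall>B. openin (top_of_set halfspace) B \<and> bounded B \<and> B \<subseteq> \<Omega> \<longrightarrow>
        (\<forall>F. F \<in> sets lebesgue \<and> F \<subseteq> halfspace \<and> compactly_contained (sym_diff F E) B \<longrightarrow>
           perimeter \<alpha> E B \<le> perimeter \<alpha> F B))"

definition alpha_cone :: "real \<Rightarrow> ((real ^ 'm) \<times> real) set" where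
  "alpha_cone \<alpha> = {(x, y). 0 \<le> y \<and> y \<le> sqrt (\<alpha> / (real CARD('m) - 1)) * norm x}"

end

theory Submission
  imports Defs
begin

text \<open>
  The proof is a calibration argument. Write $\kappa = \alpha/(m-1)$ and
  $u(x,y) = y^4 - \kappa^2 |x|^4$, so that the cone is $E = \{y \ge 0,\ u \le 0\}$, and consider the
  field $\xi = y^\alpha \nabla u / |\nabla u|$. It satisfies $|\xi| \le y^\alpha$ and
  $\xi \cdot \nabla u = y^\alpha |\nabla u|$, and its divergence has the sign of $u$: with $Y = y^2$ and
  $t = \kappa |x|^2$ it is a nonnegative multiple of
  $(Y - t)\,((m-1)Y^3 - 3tY^2 - 3t^2Y + \alpha t^3)$, and the second factor is nonnegative for
  $\alpha \ge 13$ (lemma \<open>divergence_calibration_sign\<close>). A function of degree four is used because the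
  quadratic function $y^2 - \kappa |x|^2$, although it defines the same cone, leads to a field whose
  divergence has the wrong sign. The threshold 13 is a convenient rational number above the minimal value
  for which the second factor is nonnegative for every $m \ge 2$.

  Let $F$ be a competitor in $B$ and let $\psi$ be an admissible field for the perimeter of $E$ in $B$.
  Choose a cutoff function $\eta$ with compact support in $B$ that is 1 on the support of $\psi$ and on the
  closure of $F \bigtriangleup E$. Then
  \[ \int_E \mathrm{div}\,\psi \le \int_E \mathrm{div}(\eta\xi) \le \int_F \mathrm{div}(\eta\xi)
     \le \mathcal{P}_\alpha(F;B). \]
  The last inequality holds because $\eta\xi$ is itself admissible. The middle one is the sign of
  $\mathrm{div}\,\xi$ on $F \setminus E$ and on $E \setminus F$. The first one
  (lemma \<open>sublevel_flux_le_calibration_flux\<close>) expresses that $\xi$ has maximal flux through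
  $\partial E$; instead of surface integrals it uses the functions
  $\varphi_n = 1/(1 + n \max(u,0)^2)$, which are nonincreasing in $u$ and tend to $\chi_E$ on the
  half-space. The field
  $\zeta = \psi - \eta\xi$ has $\zeta \cdot \nabla u \le 0$, so that
  $0 = \int \mathrm{div}(\varphi_n \zeta) \ge \int \varphi_n\, \mathrm{div}\,\zeta$, and the limit
  $n \to \infty$ gives $\int_E \mathrm{div}\,\zeta \le 0$
  (lemma \<open>integral_divergence_sublevel_le_0\<close>). Taking the supremum over $\psi$ finishes the proof.
  The first inequality alone also shows that $E$ has locally finite perimeter: on a set $U$ with compact
  closure one cutoff function serves all fields $\psi$ supported in $U$.
\<close>

section \<open>Integrals of directional derivatives\<close>

text \<open>
  The difference quotients of \<open>g\<close> have integral 0 because Lebesgue measure is invariant under translation,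
  and the Lipschitz bound lets them pass to the limit by dominated convergence. This replaces an
  integration along coordinate lines, and it tolerates the kink that a field extended by zero across the
  boundary of the half-space has there.
\<close>

lemma integral_directional_derivative_eq_0:
  fixes g k :: "'a::euclidean_space \<Rightarrow> real"
  assumes lip: "\<And>x y. \<bar>g x - g y\<bar> \<le> L * norm (x - y)"
    and supp: "\<And>x. R < norm x \<Longrightarrow> g x = 0"
    and lim: "AE x in lborel. (\<lambda>n. real (Suc n) * (g (x + (1 / real (Suc n)) *\<^sub>R b) - g x)) \<longlonglongrightarrow> k x"
    and k: "k \<in> borel_measurable borel"
  shows "integral\<^sup>L lborel k = 0"
proof -
  let ?s = "\<lambda>n x. real (Suc n) * (g (x + (1 / real (Suc n)) *\<^sub>R b) - g x)"
  have "continuous_on UNIV g"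
  proof (rule continuous_onI)
    fix x :: 'a and e :: real assume "0 < e"
    have "dist (g y) (g x) \<le> e" if "dist y x < e / (\<bar>L\<bar> + 1)" for y
    proof -
      have "dist (g y) (g x) \<le> \<bar>L\<bar> * dist y x"
        using lip[of y x] by (simp add: dist_norm) (smt (verit) mult_right_mono norm_ge_zero)
      also have "\<dots> \<le> (\<bar>L\<bar> + 1) * dist y x" by (simp add: mult_right_mono)
      also have "\<dots> \<le> e" using that by (simp add: field_simps)
      finally show ?thesis .
    qed
    then show "\<exists>d>0. \<forall>y\<in>UNIV. dist y x < d \<longrightarrow> dist (g y) (g x) \<le> e"
      using \<open>0 < e\<close> by (intro exI[of _ "e / (\<bar>L\<bar> + 1)"]) auto
  qed
  then have gm [measurable]: "g \<in> borel_measurable borel"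
    by (rule borel_measurable_continuous_onI)
  have bd: "\<bar>?s n x\<bar> \<le> L * norm b * indicator (cball 0 (R + norm b)) x" for n x
  proof (cases "norm x \<le> R + norm b")
    case True
    have "\<bar>g (x + (1 / real (Suc n)) *\<^sub>R b) - g x\<bar> \<le> L * norm ((1 / real (Suc n)) *\<^sub>R b)"
      using lip[of "x + (1 / real (Suc n)) *\<^sub>R b" x] by (simp only: add_diff_cancel_left')
    then have "\<bar>?s n x\<bar> \<le> real (Suc n) * (L * norm ((1 / real (Suc n)) *\<^sub>R b))"
      by (simp only: abs_mult abs_of_nat mult_left_mono of_nat_0_le_iff)
    also have "\<dots> = L * norm b" by (simp del: of_nat_Suc)
    finally show ?thesis using True by simp
  next
    case False
    have *: "norm ((1 / real (Suc n)) *\<^sub>R b) \<le> norm b"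
      by (simp add: divide_le_eq mult_le_cancel_left1)
    have "norm x \<le> norm (x + (1 / real (Suc n)) *\<^sub>R b) + norm ((1 / real (Suc n)) *\<^sub>R b)"
      by (metis add_diff_cancel_right' norm_triangle_ineq4)
    then have "R < norm (x + (1 / real (Suc n)) *\<^sub>R b)" using False * by linarith
    then have "g (x + (1 / real (Suc n)) *\<^sub>R b) = 0" by (rule supp)
    moreover have "g x = 0" using False norm_ge_zero[of b] by (intro supp) linarith
    ultimately show ?thesis using False by simp
  qed
  have w: "integrable lborel (\<lambda>x. L * norm b * indicator (cball 0 (R + norm b)) x :: real)"
    by (intro integrable_mult_right integrable_real_indicator) (simp_all add: emeasure_bounded_finite[unfolded infinity_ennreal_def])
  have gint: "integrable lborel g"
  proof (rule Bochner_Integration.integrable_bound)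
    show "integrable lborel (\<lambda>x. (\<bar>L\<bar> * \<bar>R\<bar> + \<bar>g 0\<bar>) * indicator (cball 0 R) (x::'a) :: real)"
      by (intro integrable_mult_right integrable_real_indicator) (simp_all add: emeasure_bounded_finite[unfolded infinity_ennreal_def])
    have "\<bar>g x\<bar> \<le> \<bar>L\<bar> * \<bar>R\<bar> + \<bar>g 0\<bar>" if "norm x \<le> R" for x
    proof -
      have "\<bar>g x\<bar> \<le> L * norm x + \<bar>g 0\<bar>" using lip[of x 0] by simp
      also have "L * norm x \<le> \<bar>L\<bar> * \<bar>R\<bar>" using that
        by (smt (verit) mult_mono mult_right_mono norm_ge_zero)
      finally show ?thesis by simp
    qed
    then show "AE x in lborel. norm (g x) \<le> norm ((\<bar>L\<bar> * \<bar>R\<bar> + \<bar>g 0\<bar>) * indicator (cball 0 R) x :: real)"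
      using supp by (auto split: split_indicator simp: not_le)
  qed simp
  have trans: "integrable lborel (\<lambda>x. g (x + c))" "(\<integral>x. g (x + c) \<partial>lborel) = integral\<^sup>L lborel g" for c
  proof -
    have "integral\<^sup>L (distr lborel borel ((+) c)) g = (\<integral>x. g (c + x) \<partial>lborel)"
      by (rule integral_distr) auto
    then show "(\<integral>x. g (x + c) \<partial>lborel) = integral\<^sup>L lborel g" by (simp add: lborel_distr_plus add.commute)
    have "integrable (distr lborel borel ((+) c)) g \<longleftrightarrow> integrable lborel (\<lambda>x. g (c + x))"
      by (rule integrable_distr_eq) auto
    then show "integrable lborel (\<lambda>x. g (x + c))" using gint by (simp add: lborel_distr_plus add.commute)
  qed
  have 0: "integral\<^sup>L lborel (?s n) = 0" for n
    using trans gint by simp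
  have "(\<lambda>n. integral\<^sup>L lborel (?s n)) \<longlonglongrightarrow> integral\<^sup>L lborel k"
  proof (rule integral_dominated_convergence[OF _ _ w lim])
    show "k \<in> borel_measurable lborel" using k by simp
    show "AE x in lborel. norm (?s n x) \<le> L * norm b * indicator (cball 0 (R + norm b)) x" for n
      using bd[of n] by (simp only: real_norm_def) simp
  qed measurable
  then show ?thesis unfolding 0 by (simp add: LIMSEQ_const_iff)
qed

section \<open>Differentiation within relatively open subsets of the half-space\<close>

lemma mem_halfspace [simp]: "z \<in> halfspace \<longleftrightarrow> 0 \<le> snd z"
  by (cases z) (auto simp: halfspace_def)

lemma closed_halfspace: "closed halfspace"
  by (simp add: halfspace_def closed_Times)

lemma convex_halfspace: "convex halfspace"
  by (simp add: halfspace_def convex_Times)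

text \<open>
  Every coordinate direction can be followed inside the half-space, at a boundary point at least
  forwards, and this determines the one-sided derivative.
\<close>

lemma has_derivative_halfspace_unique:
  fixes f :: "(real ^ 'm) \<times> real \<Rightarrow> 'b::real_normed_vector"
  assumes "(f has_derivative D) (at z within halfspace)" "(f has_derivative D') (at z within halfspace)"
    and "z \<in> halfspace"
  shows "D = D'"
proof (rule frechet_derivative_unique_within[OF assms(1,2)])
  fix i :: "(real ^ 'm) \<times> real" and e :: real
  assume "i \<in> Basis" "0 < e"
  then have "0 \<le> snd i" by (auto simp: Basis_prod_def)
  then show "\<exists>d. 0 < \<bar>d\<bar> \<and> \<bar>d\<bar> < e \<and> z + d *\<^sub>R i \<in> halfspace"
    using assms(3) \<open>0 < e\<close> by (intro exI[of _ "e / 2"]) auto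
qed

lemma at_within_relatively_open:
  assumes "openin (top_of_set H) B" "z \<in> B"
  shows "at z within B = at z within H"
proof -
  obtain T where "open T" "B = H \<inter> T" using assms(1) by (auto simp: openin_open)
  then show ?thesis using assms(2) by (intro at_within_nhd[of z T]) auto
qed

text \<open>
  Carrying the derivative as an explicit argument keeps it free of the domain, so that the same formula
  serves on the half-space and on each of its relatively open subsets.
\<close>

definition C1_on :: "'a::real_normed_vector set \<Rightarrow> ('a \<Rightarrow> 'b::real_normed_vector) \<Rightarrow> ('a \<Rightarrow> 'a \<Rightarrow> 'b) \<Rightarrow> bool" where
  "C1_on S f D \<longleftrightarrow> (\<forall>z\<in>S. (f has_derivative D z) (at z within S)) \<and> (\<forall>v. continuous_on S (\<lambda>z. D z v))"

lemma C1_onD: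
  assumes "C1_on S f D"
  shows "z \<in> S \<Longrightarrow> (f has_derivative D z) (at z within S)" "continuous_on S (\<lambda>z. D z v)"
    "continuous_on S f"
  using assms unfolding C1_on_def
  by (auto simp: continuous_on_eq_continuous_within has_derivative_continuous)

lemma C1c_fields_C1_on:
  "\<psi> \<in> C1c_fields S \<Longrightarrow> C1_on S \<psi> (\<lambda>z. frechet_derivative \<psi> (at z within S))"
  by (auto simp: C1c_fields_def C1_on_def differentiable_on_def frechet_derivative_works)

lemma frechet_derivative_relatively_open:
  fixes f :: "(real ^ 'm) \<times> real \<Rightarrow> 'b::real_normed_vector"
  assumes B: "openin (top_of_set halfspace) B" "z \<in> B" and f: "(f has_derivative D) (at z within B)"
  shows "frechet_derivative f (at z within B) = D"
proof -
  have z: "z \<in> halfspace" using openin_imp_subset[OF B(1)] B(2) by blast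
  have "(f has_derivative frechet_derivative f (at z within B)) (at z within B)"
    using f frechet_derivative_works differentiable_def by blast
  then show ?thesis
    using has_derivative_halfspace_unique[OF _ _ z] f by (simp add: at_within_relatively_open[OF B])
qed

text \<open>
  The bridge from an explicit derivative to the Frechet derivative within \<open>B\<close>, which is what
  \<open>C1c_fields\<close> and \<open>divergence\<close> refer to.
\<close>

lemma C1c_fieldsI:
  fixes \<psi> :: "(real ^ 'm) \<times> real \<Rightarrow> (real ^ 'm) \<times> real"
  assumes B: "openin (top_of_set halfspace) B" and C1: "C1_on B \<psi> D"
    and K: "compact K" "K \<subseteq> B" "\<And>z. z \<in> B - K \<Longrightarrow> \<psi> z = 0"
  shows "\<psi> \<in> C1c_fields B" "\<And>z. z \<in> B \<Longrightarrow> frechet_derivative \<psi> (at z within B) = D z"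
    "\<And>z. z \<in> B \<Longrightarrow> divergence B \<psi> z = (\<Sum>b\<in>Basis. D z b \<bullet> b)"
proof -
  show fr: "frechet_derivative \<psi> (at z within B) = D z" if "z \<in> B" for z
    by (rule frechet_derivative_relatively_open[OF B that C1_onD(1)[OF C1 that]])
  then show "divergence B \<psi> z = (\<Sum>b\<in>Basis. D z b \<bullet> b)" if "z \<in> B" for z
    using that by (simp add: divergence_def)
  have "closure {z \<in> B. \<psi> z \<noteq> 0} \<subseteq> K"
    using K by (intro closure_minimal compact_imp_closed) auto
  moreover from this have "compact (closure {z \<in> B. \<psi> z \<noteq> 0})"
    using K(1) compact_closure bounded_subset closure_subset compact_imp_bounded by (metis (no_types, lifting) subset_trans)
  ultimately show "\<psi> \<in> C1c_fields B"
    using C1 K(2) fr unfolding C1c_fields_def compactly_contained_def C1_on_def differentiable_on_def differentiable_def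
    by (auto cong: continuous_on_cong)
qed

lemma C1c_fields_support:
  assumes "\<psi> \<in> C1c_fields B"
  obtains K where "compact K" "K \<subseteq> B" "\<And>z. z \<in> B - K \<Longrightarrow> \<psi> z = 0"
proof
  show "compact (closure {z \<in> B. \<psi> z \<noteq> 0})" "closure {z \<in> B. \<psi> z \<noteq> 0} \<subseteq> B"
    using assms by (auto simp: C1c_fields_def compactly_contained_def)
  show "\<psi> z = 0" if "z \<in> B - closure {z \<in> B. \<psi> z \<noteq> 0}" for z
    using that closure_subset[of "{z \<in> B. \<psi> z \<noteq> 0}"] by auto
qed

lemma frechet_derivative_eq_0_off_support:
  fixes \<psi> :: "(real ^ 'm) \<times> real \<Rightarrow> 'b::real_normed_vector"
  assumes B: "openin (top_of_set halfspace) B" and K: "closed K"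
    and \<psi>: "\<And>z. z \<in> B - K \<Longrightarrow> \<psi> z = 0" and z: "z \<in> B - K"
  shows "frechet_derivative \<psi> (at z within B) = (\<lambda>v. 0)"
proof -
  have BK: "openin (top_of_set halfspace) (B - K)"
    using B K by (metis Diff_eq openin_Int_open open_Compl)
  have "(\<psi> has_derivative (\<lambda>v. 0)) (at z within B - K)"
    by (rule has_derivative_transform[OF z _ has_derivative_const[of 0]]) (use \<psi> in auto)
  then have "(\<psi> has_derivative (\<lambda>v. 0)) (at z within B)"
    using z by (simp add: at_within_relatively_open[OF BK z] at_within_relatively_open[OF B])
  then show ?thesis using frechet_derivative_relatively_open[OF B] z by blast
qed

text \<open>
  Fields on a relatively open set extend to the half-space, where convexity and the divergence theorem are
  available. The half-space is covered by \<open>B\<close> and the complement of the support, both relatively open, and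
  the extension is of class $C^1$ on each.
\<close>

lemma zero_extension_C1c_fields:
  fixes \<psi> :: "(real ^ 'm) \<times> real \<Rightarrow> (real ^ 'm) \<times> real"
  assumes B: "openin (top_of_set halfspace) B" and \<psi>: "\<psi> \<in> C1c_fields B"
  defines "\<psi>' \<equiv> \<lambda>z. if z \<in> B then \<psi> z else 0"
  shows "\<psi>' \<in> C1c_fields halfspace"
    "\<And>z. z \<in> halfspace \<Longrightarrow> divergence halfspace \<psi>' z = (if z \<in> B then divergence B \<psi> z else 0)"
proof -
  obtain K where K: "compact K" "K \<subseteq> B" "\<And>z. z \<in> B - K \<Longrightarrow> \<psi> z = 0"
    using C1c_fields_support[OF \<psi>] by blast
  have BH: "B \<subseteq> halfspace" using openin_imp_subset[OF B] .
  define D where "D = (\<lambda>z. if z \<in> B then frechet_derivative \<psi> (at z within B) else (\<lambda>v. 0))"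
  note C1 = C1c_fields_C1_on[OF \<psi>]
  have HK: "openin (top_of_set halfspace) (halfspace - K)"
    using K(1) by (auto simp: openin_open Diff_eq intro!: exI[of _ "- K"] compact_imp_closed)
  have D1: "(\<psi>' has_derivative D z) (at z within halfspace)" if z: "z \<in> B" for z
  proof -
    have "(\<psi>' has_derivative D z) (at z within B)"
      by (rule has_derivative_transform[OF z, of _ \<psi>])
        (use C1_onD(1)[OF C1 z] z in \<open>auto simp: \<psi>'_def D_def\<close>)
    then show ?thesis by (simp add: at_within_relatively_open[OF B z])
  qed
  have D0: "D z = (\<lambda>v. 0)" if z: "z \<in> halfspace - K" for z
    using frechet_derivative_eq_0_off_support[OF B compact_imp_closed[OF K(1)] K(3)] z
    by (auto simp: D_def simp del: split_paired_All)
  have D2: "(\<psi>' has_derivative D z) (at z within halfspace)" if z: "z \<in> halfspace - K" for z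
  proof -
    have "(\<psi>' has_derivative (\<lambda>v. 0)) (at z within halfspace - K)"
      by (rule has_derivative_transform[OF z _ has_derivative_const[of 0]])
        (use K z in \<open>auto simp: \<psi>'_def\<close>)
    then show ?thesis by (simp only: at_within_relatively_open[OF HK z] D0[OF z])
  qed
  have "C1_on halfspace \<psi>' D"
    unfolding C1_on_def continuous_on_eq_continuous_within
  proof (intro conjI allI ballI)
    fix z :: "(real ^ 'm) \<times> real" and v assume z: "z \<in> halfspace"
    show "(\<psi>' has_derivative D z) (at z within halfspace)"
      using z D1[of z] D2[of z] K(2) by blast
    show "continuous (at z within halfspace) (\<lambda>z. D z v)"
    proof (cases "z \<in> B")
      case True
      have "continuous_on B (\<lambda>z. D z v)"
        using C1_onD(2)[OF C1, of v] by (rule continuous_on_eq) (simp add: D_def)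
      then show ?thesis
        using True by (simp add: continuous_on_eq_continuous_within flip: at_within_relatively_open[OF B])
    next
      case False
      then have z: "z \<in> halfspace - K" using z K by auto
      have "continuous_on (halfspace - K) (\<lambda>z. D z v)"
        by (rule continuous_on_eq[of _ "\<lambda>_. 0"]) (auto simp: D0)
      then show ?thesis
        using z unfolding continuous_on_eq_continuous_within at_within_relatively_open[OF HK z, symmetric] by blast
    qed
  qed
  note * = C1c_fieldsI[OF openin_subtopology_self this K(1)]
  show "\<psi>' \<in> C1c_fields halfspace"
    by (rule *) (use K BH in \<open>auto simp: \<psi>'_def\<close>)
  show "divergence halfspace \<psi>' z = (if z \<in> B then divergence B \<psi> z else 0)" if "z \<in> halfspace" for z
    by (subst *(3)) (use K BH that in \<open>auto simp: \<psi>'_def D_def divergence_def\<close>)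
qed

section \<open>The divergence theorem on the half-space\<close>

lemma linear_sum_Basis:
  fixes f :: "'a::euclidean_space \<Rightarrow> real"
  assumes "linear f"
  shows "(\<Sum>b\<in>Basis. f b * (x \<bullet> b)) = f x"
proof -
  have "f x = f (\<Sum>b\<in>Basis. (x \<bullet> b) *\<^sub>R b)" by (simp add: euclidean_representation)
  also have "\<dots> = (\<Sum>b\<in>Basis. f b * (x \<bullet> b))"
    by (simp add: linear_sum[OF assms] linear_cmul[OF assms] mult.commute)
  finally show ?thesis by simp
qed

lemma C1c_fields_scaleR:
  fixes \<psi> :: "(real ^ 'm) \<times> real \<Rightarrow> (real ^ 'm) \<times> real"
  assumes B: "openin (top_of_set halfspace) B"
    and \<eta>: "C1_on B \<eta> D\<eta>" and \<psi>: "C1_on B \<psi> D\<psi>"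
    and K: "compact K" "K \<subseteq> B" "\<And>z. z \<in> B - K \<Longrightarrow> \<eta> z = 0 \<or> \<psi> z = 0"
  shows "(\<lambda>z. \<eta> z *\<^sub>R \<psi> z) \<in> C1c_fields B"
    "\<And>z. z \<in> B \<Longrightarrow> divergence B (\<lambda>z. \<eta> z *\<^sub>R \<psi> z) z = \<eta> z * (\<Sum>b\<in>Basis. D\<psi> z b \<bullet> b) + D\<eta> z (\<psi> z)"
proof -
  have C1: "C1_on B (\<lambda>z. \<eta> z *\<^sub>R \<psi> z) (\<lambda>z v. \<eta> z *\<^sub>R D\<psi> z v + D\<eta> z v *\<^sub>R \<psi> z)"
    using \<eta> \<psi> unfolding C1_on_def
    by (auto intro!: derivative_eq_intros continuous_intros C1_onD(3)[OF \<eta>] C1_onD(3)[OF \<psi>])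
  show "(\<lambda>z. \<eta> z *\<^sub>R \<psi> z) \<in> C1c_fields B"
    by (rule C1c_fieldsI[OF B C1 K(1,2)]) (use K(3) in force)
  fix z assume z: "z \<in> B"
  have lin: "linear (D\<eta> z)"
    using C1_onD(1)[OF \<eta> z] has_derivative_linear by blast
  note * = linear_sum_Basis[OF lin, of "\<psi> z"]
  have "divergence B (\<lambda>z. \<eta> z *\<^sub>R \<psi> z) z = (\<Sum>b\<in>Basis. (\<eta> z *\<^sub>R D\<psi> z b + D\<eta> z b *\<^sub>R \<psi> z) \<bullet> b)"
    by (rule C1c_fieldsI(3)[OF B C1 K(1,2) _ z]) (use K(3) in force)
  then show "divergence B (\<lambda>z. \<eta> z *\<^sub>R \<psi> z) z = \<eta> z * (\<Sum>b\<in>Basis. D\<psi> z b \<bullet> b) + D\<eta> z (\<psi> z)"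
    by (simp add: inner_add_left sum.distrib sum_distrib_left flip: *)
qed

lemma openin_halfspace_self: "openin (top_of_set halfspace) (halfspace :: ((real ^ 'm) \<times> real) set)"
  by simp

lemma continuous_on_halfspace_integrable:
  fixes f :: "(real ^ 'm) \<times> real \<Rightarrow> real"
  assumes f: "continuous_on halfspace f" and K: "compact K" "\<And>z. z \<in> halfspace - K \<Longrightarrow> f z = 0"
  shows "(\<lambda>z. indicator halfspace z * f z) \<in> borel_measurable borel"
    "integrable lborel (\<lambda>z. indicator halfspace z * f z)"
    "integrable lebesgue (\<lambda>z. indicator halfspace z * f z)"
proof -
  have HK: "compact (halfspace \<inter> K)" using K(1) closed_halfspace by blast
  show m: "(\<lambda>z. indicator halfspace z * f z) \<in> borel_measurable borel"
    using borel_measurable_continuous_on_indicator[OF borel_closed[OF closed_halfspace] f] by simp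
  have "integrable lborel (\<lambda>z. indicator (halfspace \<inter> K) z *\<^sub>R f z)"
    by (intro borel_integrable_compact HK continuous_on_subset[OF f]) auto
  also have "(\<lambda>z. indicator (halfspace \<inter> K) z *\<^sub>R f z) = (\<lambda>z. indicator halfspace z * f z)"
    using K(2) by (auto simp: fun_eq_iff split: split_indicator)
  finally show "integrable lborel (\<lambda>z. indicator halfspace z * f z)" .
  then show "integrable lebesgue (\<lambda>z. indicator halfspace z * f z)"
    using m integrable_completion by blast
qed

lemma continuous_on_divergence:
  "\<psi> \<in> C1c_fields S \<Longrightarrow> continuous_on S (divergence S \<psi>)"
  unfolding divergence_def C1c_fields_def by (auto intro!: continuous_intros)

lemma divergence_eq_0_off_support:
  fixes \<psi> :: "(real ^ 'm) \<times> real \<Rightarrow> (real ^ 'm) \<times> real"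
  assumes "openin (top_of_set halfspace) B" "closed K" "\<And>z. z \<in> B - K \<Longrightarrow> \<psi> z = 0" "z \<in> B - K"
  shows "divergence B \<psi> z = 0"
  using frechet_derivative_eq_0_off_support[OF assms] by (simp add: divergence_def)

lemma divergence_integrable:
  fixes \<psi> :: "(real ^ 'm) \<times> real \<Rightarrow> (real ^ 'm) \<times> real"
  assumes "\<psi> \<in> C1c_fields halfspace"
  shows "integrable lebesgue (\<lambda>z. indicator halfspace z * divergence halfspace \<psi> z)"
proof -
  obtain K where K: "compact K" "K \<subseteq> halfspace" "\<And>z. z \<in> halfspace - K \<Longrightarrow> \<psi> z = 0"
    using C1c_fields_support[OF assms] by blast
  show ?thesis
    using continuous_on_halfspace_integrable(3)[OF continuous_on_divergence[OF assms] K(1)]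
      divergence_eq_0_off_support[OF openin_halfspace_self compact_imp_closed[OF K(1)] K(3)] by auto
qed

lemma has_derivative_difference_quotient_LIMSEQ:
  fixes g :: "'a::real_normed_vector \<Rightarrow> real"
  assumes "(g has_derivative g') (at z)"
  shows "(\<lambda>n. real (Suc n) * (g (z + (1 / real (Suc n)) *\<^sub>R b) - g z)) \<longlonglongrightarrow> g' b"
proof -
  have lin: "linear g'" using assms has_derivative_linear by blast
  have "((\<lambda>t. g (z + t *\<^sub>R b)) has_derivative (\<lambda>t. g' (t *\<^sub>R b))) (at 0)"
    by (rule has_derivative_compose[of "\<lambda>t. z + t *\<^sub>R b" "\<lambda>t. t *\<^sub>R b" _ _ g g'])
      (use assms in \<open>auto intro!: derivative_eq_intros\<close>)
  then have "((\<lambda>t. g (z + t *\<^sub>R b)) has_real_derivative g' b) (at 0)"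
    by (simp add: has_field_derivative_def linear_cmul[OF lin] mult.commute[of _ "g' b"] mult_commute_abs)
  then have *: "((\<lambda>h. (g (z + h *\<^sub>R b) - g z) / h) \<longlongrightarrow> g' b) (at 0)"
    by (simp add: DERIV_def)
  have "filterlim (\<lambda>n. 1 / real (Suc n)) (at 0) sequentially"
    unfolding filterlim_at using LIMSEQ_inverse_real_of_nat by (auto simp: divide_inverse)
  from filterlim_compose[OF * this] show ?thesis
    by (simp add: divide_inverse mult.commute)
qed

text \<open>
  Each component of a field that vanishes on the boundary hyperplane extends by zero to a Lipschitz function
  on the whole space, which is differentiable off the hyperplane. So the divergence integrates to zero
  component by component.
\<close>

lemma integral_divergence_eq_0:
  fixes \<psi> :: "(real ^ 'm) \<times> real \<Rightarrow> (real ^ 'm) \<times> real"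
  assumes \<psi>: "\<psi> \<in> C1c_fields halfspace" and bdy: "\<And>z. snd z = 0 \<Longrightarrow> \<psi> z = 0"
  shows "(LINT z:halfspace|lebesgue. divergence halfspace \<psi> z) = 0"
proof -
  obtain K where K: "compact K" "K \<subseteq> halfspace" "\<And>z. z \<in> halfspace - K \<Longrightarrow> \<psi> z = 0"
    using C1c_fields_support[OF \<psi>] by blast
  define D where "D = (\<lambda>z. frechet_derivative \<psi> (at z within halfspace))"
  have C1: "C1_on halfspace \<psi> D" using C1c_fields_C1_on[OF \<psi>] by (simp add: D_def)
  have D0: "D z = (\<lambda>v. 0)" if "z \<in> halfspace - K" for z
    unfolding D_def
    by (rule frechet_derivative_eq_0_off_support[OF openin_halfspace_self compact_imp_closed[OF K(1)] K(3) that])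
  \<comment> \<open>Composing with the nearest-point projection onto the half-space is the extension by zero.\<close>
  define P where "P = (\<lambda>z :: (real ^ 'm) \<times> real. (fst z, max 0 (snd z)))"
  have P_in: "P z \<in> halfspace" for z by (simp add: P_def)
  have P_lip: "norm (P x - P y) \<le> norm (x - y)" for x y
  proof -
    have "\<bar>max 0 (snd x) - max 0 (snd y)\<bar> \<le> \<bar>snd x - snd y\<bar>" by linarith
    then have "(max 0 (snd x) - max 0 (snd y))\<^sup>2 \<le> (snd x - snd y)\<^sup>2" by (simp only: abs_le_square_iff)
    then show ?thesis by (simp add: P_def norm_prod_def real_sqrt_le_mono)
  qed
  obtain R where R: "K \<subseteq> cball 0 R"
    using K(1) bounded_subset_ballI compact_imp_bounded by (metis bounded_iff mem_cball_0 subsetI)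
  let ?k = "\<lambda>b z. indicator halfspace z * (D z b \<bullet> b)"
  have k_cont: "continuous_on halfspace (\<lambda>z. D z c \<bullet> b)" for b c
    using C1_onD(2)[OF C1] by (intro continuous_intros)
  have k_int: "?k b \<in> borel_measurable borel" "integrable lborel (?k b)" for b
    using continuous_on_halfspace_integrable[OF k_cont K(1)] D0 by auto
  have zero: "integral\<^sup>L lborel (?k b) = 0" for b
  proof -
    have "\<exists>M\<ge>0. \<forall>z\<in>halfspace. \<bar>D z i \<bullet> b\<bar> \<le> M" for i
    proof -
      have "bounded ((\<lambda>z. D z i \<bullet> b) ` K)"
        by (intro compact_imp_bounded compact_continuous_image continuous_on_subset[OF k_cont] K)
      then obtain M where "\<forall>z\<in>K. \<bar>D z i \<bullet> b\<bar> \<le> M" by (auto simp: bounded_iff)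
      then have "\<forall>z\<in>halfspace. \<bar>D z i \<bullet> b\<bar> \<le> max 0 M"
        using D0 by (metis DiffI abs_zero inner_zero_left max.cobounded1 max.coboundedI2)
      then show ?thesis by (intro exI[of _ "max 0 M"]) auto
    qed
    then obtain M where M: "\<And>i. 0 \<le> M i" "\<And>i z. z \<in> halfspace \<Longrightarrow> \<bar>D z i \<bullet> b\<bar> \<le> M i" by metis
    define L where "L = (\<Sum>i\<in>Basis. M i)"
    have onorm: "onorm (\<lambda>v. D z v \<bullet> b) \<le> L" if z: "z \<in> halfspace" for z
    proof (rule onorm_le)
      fix v
      have lin: "linear (D z)" using C1_onD(1)[OF C1 z] has_derivative_linear by blast
      have "D z v = D z (\<Sum>i\<in>Basis. (v \<bullet> i) *\<^sub>R i)" by (simp add: euclidean_representation)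
      also have "\<dots> = (\<Sum>i\<in>Basis. (v \<bullet> i) *\<^sub>R D z i)" by (simp add: linear_sum[OF lin] linear_cmul[OF lin])
      finally have "\<bar>D z v \<bullet> b\<bar> \<le> (\<Sum>i\<in>Basis. \<bar>(v \<bullet> i) * (D z i \<bullet> b)\<bar>)"
        by (simp add: inner_sum_left sum_abs)
      also have "\<dots> \<le> (\<Sum>i\<in>Basis. M i * norm v)"
        using M z by (intro sum_mono) (simp add: abs_mult mult.commute[of "M _"] mult_mono Basis_le_norm)
      finally show "norm (D z v \<bullet> b) \<le> L * norm v" by (simp add: L_def sum_distrib_right)
    qed
    define g where "g = (\<lambda>z. \<psi> (P z) \<bullet> b)"
    show ?thesis
    proof (rule integral_directional_derivative_eq_0[where g = g and L = L and R = R and b = b])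
      show "\<bar>g x - g y\<bar> \<le> L * norm (x - y)" for x y
      proof -
        have "norm (\<psi> (P x) \<bullet> b - \<psi> (P y) \<bullet> b) \<le> L * norm (P x - P y)"
          by (rule differentiable_bound[OF convex_halfspace _ onorm P_in P_in])
            (auto intro!: derivative_eq_intros C1_onD(1)[OF C1])
        also have "\<dots> \<le> L * norm (x - y)"
          using M(1) by (intro mult_left_mono P_lip) (simp add: L_def sum_nonneg)
        finally show ?thesis by (simp add: g_def)
      qed
      show "g x = 0" if "R < norm x" for x
      proof (cases "0 \<le> snd x")
        case True
        then have "P x = x" by (simp add: P_def)
        moreover have "x \<notin> K" using R that by auto
        ultimately show ?thesis using True K(3)[of x] by (simp add: g_def)
      next
        case False
        then show ?thesis using bdy[of "P x"] by (simp add: g_def P_def)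
      qed
      show "?k b \<in> borel_measurable borel" by (rule k_int)
      have "(g has_derivative (\<lambda>v. indicator halfspace z * (D z v \<bullet> b))) (at z)" if z: "snd z \<noteq> 0" for z
      proof (cases "0 < snd z")
        case True
        have op: "open {z :: (real ^ 'm) \<times> real. 0 < snd z}"
          by (intro open_Collect_less continuous_intros)
        have "at z within halfspace = at z"
          using True op by (intro at_within_open_subset[of z "{z. 0 < snd z}"]) auto
        then have "(\<psi> has_derivative D z) (at z)" using C1_onD(1)[OF C1, of z] True by simp
        then have "((\<lambda>z. \<psi> z \<bullet> b) has_derivative (\<lambda>v. indicator halfspace z * (D z v \<bullet> b))) (at z)"
          using True by (auto intro!: derivative_eq_intros)
        then show ?thesis
          by (rule has_derivative_transform_within_open[OF _ op]) (use True in \<open>auto simp: g_def P_def\<close>)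
      next
        case False
        have op: "open {z :: (real ^ 'm) \<times> real. snd z < 0}"
          by (intro open_Collect_less continuous_intros)
        have "((\<lambda>z. 0) has_derivative (\<lambda>v. indicator halfspace z * (D z v \<bullet> b))) (at z)"
          using False z by simp
        then show ?thesis
          by (rule has_derivative_transform_within_open[OF _ op]) (use False z bdy in \<open>auto simp: g_def P_def\<close>)
      qed
      then have lim: "(\<lambda>n. real (Suc n) * (g (z + (1 / real (Suc n)) *\<^sub>R b) - g z)) \<longlonglongrightarrow> ?k b z"
        if "snd z \<noteq> 0" for z
        using has_derivative_difference_quotient_LIMSEQ[where g' = "\<lambda>v. indicator halfspace z * (D z v \<bullet> b)"] that by blast
      have "negligible {z :: (real ^ 'm) \<times> real. (0, 1) \<bullet> z = 0}"
        by (rule negligible_hyperplane) (simp add: zero_prod_def)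
      then have "{z :: (real ^ 'm) \<times> real. snd z = 0} \<in> null_sets lebesgue"
        by (simp add: negligible_iff_null_sets inner_prod_def)
      moreover have "{z :: (real ^ 'm) \<times> real. snd z = 0} \<in> sets borel"
        by (intro borel_closed closed_Collect_eq continuous_intros)
      ultimately have "{z :: (real ^ 'm) \<times> real. snd z = 0} \<in> null_sets lborel"
        by (simp add: null_sets_completion_iff)
      then show "AE z in lborel. (\<lambda>n. real (Suc n) * (g (z + (1 / real (Suc n)) *\<^sub>R b) - g z)) \<longlonglongrightarrow> ?k b z"
        by (rule AE_I') (use lim in blast)
    qed
  qed
  have "(LINT z:halfspace|lebesgue. divergence halfspace \<psi> z) = (\<integral>z. (\<Sum>b\<in>Basis. ?k b z) \<partial>lebesgue)"
    by (simp add: set_lebesgue_integral_def divergence_def D_def sum_distrib_left)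
  also have "\<dots> = (\<integral>z. (\<Sum>b\<in>Basis. ?k b z) \<partial>lborel)"
    using k_int by (intro integral_completion borel_measurable_sum) simp
  also have "\<dots> = (\<Sum>b\<in>Basis. integral\<^sup>L lborel (?k b))"
    using k_int by (intro Bochner_Integration.integral_sum)
  finally show ?thesis by (simp add: zero)
qed

section \<open>Flux through the boundary of a sublevel set\<close>

text \<open>
  The function \<open>\<lambda>s. (max 0 s)\<^sup>2\<close> is a $C^1$ building block that distinguishes the two signs of \<open>s\<close>.
  It serves to approximate indicator functions and to construct cutoff functions.
\<close>

lemma DERIV_max_0_squared:
  "((\<lambda>s::real. (max 0 s)\<^sup>2) has_real_derivative 2 * max 0 s) (at s)"
proof -
  consider "s < 0" | "s = 0" | "0 < s" by linarith
  then show ?thesis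
  proof cases
    case 1
    have "((\<lambda>s. 0) has_real_derivative 2 * max 0 s) (at s)" using 1 by simp
    then show ?thesis
      by (rule has_field_derivative_transform_within_open[where S = "{..<0}"]) (use 1 in auto)
  next
    case 2
    have "((\<lambda>h :: real. (max 0 h)\<^sup>2 / h) \<longlongrightarrow> 0) (at 0)"
    proof (rule Lim_null_comparison)
      show "\<forall>\<^sub>F h in at 0. norm ((max 0 h)\<^sup>2 / h) \<le> \<bar>h :: real\<bar>"
        by (intro always_eventually allI) (auto simp: max_def power2_eq_square)
      show "((\<lambda>h. \<bar>h :: real\<bar>) \<longlongrightarrow> 0) (at 0)" by (rule tendsto_rabs_zero) (rule tendsto_ident_at)
    qed
    then show ?thesis using 2 by (simp add: DERIV_def)
  next
    case 3
    have "((\<lambda>s. s\<^sup>2) has_real_derivative 2 * max 0 s) (at s)"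
      using 3 by (auto intro!: derivative_eq_intros)
    then show ?thesis
      by (rule has_field_derivative_transform_within_open[where S = "{0<..}"]) (use 3 in auto)
  qed
qed

lemma has_derivative_max_0_squared:
  assumes "(f has_derivative f') (at z within S)"
  shows "((\<lambda>z. (max 0 (f z :: real))\<^sup>2) has_derivative (\<lambda>v. 2 * max 0 (f z) * f' v)) (at z within S)"
  using DERIV_compose_FDERIV[OF DERIV_max_0_squared assms] by (simp add: mult.commute)

text \<open>
  If \<open>\<zeta>\<close> points into the sublevel sets of \<open>u\<close>, its outward flux through the boundary of
  \<open>{u \<le> 0}\<close> is nonpositive. The indicator of the sublevel set is approximated by \<open>\<phi> n\<close>, a
  nonincreasing $C^1$ function of \<open>u\<close> that is exactly 1 for \<open>u \<le> 0\<close>, so that the limit is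
  the indicator of the sublevel set at every point, the level set \<open>{u = 0}\<close> included.
\<close>

lemma integral_divergence_sublevel_le_0:
  fixes \<zeta> :: "(real ^ 'm) \<times> real \<Rightarrow> (real ^ 'm) \<times> real" and u :: "(real ^ 'm) \<times> real \<Rightarrow> real"
  assumes \<zeta>: "\<zeta> \<in> C1c_fields halfspace" and bdy: "\<And>z. snd z = 0 \<Longrightarrow> \<zeta> z = 0"
    and u: "C1_on halfspace u Du" and le: "\<And>z. z \<in> halfspace \<Longrightarrow> Du z (\<zeta> z) \<le> 0"
  shows "(LINT z:halfspace|lebesgue. indicator {z. u z \<le> 0} z * divergence halfspace \<zeta> z) \<le> 0"
proof -
  define \<phi> where "\<phi> = (\<lambda>n z. 1 / (1 + real n * (max 0 (u z))\<^sup>2))"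
  define D\<phi> where "D\<phi> = (\<lambda>n z v. - (real n * (2 * max 0 (u z) * Du z v)) / (1 + real n * (max 0 (u z))\<^sup>2)\<^sup>2)"
  have pos: "0 < 1 + real n * (max 0 (u z))\<^sup>2" for n z by (simp add: add_pos_nonneg)
  have \<phi>_C1: "C1_on halfspace (\<phi> n) (D\<phi> n)" for n
    unfolding C1_on_def
  proof (intro conjI ballI allI)
    show "continuous_on halfspace (\<lambda>z. D\<phi> n z v)" for v
      unfolding D\<phi>_def using pos[of n]
      by (intro continuous_intros C1_onD[OF u]) (auto simp: less_imp_neq[symmetric])
    show "(\<phi> n has_derivative D\<phi> n z) (at z within halfspace)" if "z \<in> halfspace" for z
    proof -
      have "((\<lambda>t. 1 / (1 + real n * t)) has_real_derivative - real n / (1 + real n * t)\<^sup>2) (at t)"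
        if "0 < 1 + real n * t" for t
        using that by (auto intro!: derivative_eq_intros simp: power2_eq_square)
      from DERIV_compose_FDERIV[OF this[OF pos] has_derivative_max_0_squared[OF C1_onD(1)[OF u that]]]
      show ?thesis by (simp add: \<phi>_def D\<phi>_def mult_ac)
    qed
  qed
  have \<phi>_le: "0 \<le> \<phi> n z" "\<phi> n z \<le> 1" for n z
    using pos[of n z] by (simp_all add: \<phi>_def)
  note C1 = C1c_fields_C1_on[OF \<zeta>]
  obtain K where K: "compact K" "K \<subseteq> halfspace" "\<And>z. z \<in> halfspace - K \<Longrightarrow> \<zeta> z = 0"
    using C1c_fields_support[OF \<zeta>] by blast
  note W = C1c_fields_scaleR[OF openin_halfspace_self \<phi>_C1 C1 K(1,2), folded divergence_def]
  let ?d = "\<lambda>z. indicator halfspace z * divergence halfspace \<zeta> z"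
  have d: "integrable lebesgue ?d"
    by (rule divergence_integrable[OF \<zeta>])
  have \<phi>d: "(\<lambda>z. \<phi> n z * ?d z) \<in> borel_measurable borel" for n
  proof -
    have "(\<lambda>z. indicator halfspace z *\<^sub>R (\<phi> n z * divergence halfspace \<zeta> z)) \<in> borel_measurable borel"
      by (intro borel_measurable_continuous_on_indicator borel_closed closed_halfspace continuous_intros
          C1_onD(3)[OF \<phi>_C1] continuous_on_divergence \<zeta>)
    then show ?thesis by (simp add: mult_ac)
  qed
  have \<phi>d_le: "\<bar>\<phi> n z * ?d z\<bar> \<le> \<bar>?d z\<bar>" for n z
    using \<phi>_le[of n z] by (simp add: abs_mult mult_left_le_one_le)
  have lim: "(\<lambda>n. \<phi> n z * ?d z) \<longlonglongrightarrow> indicator {z. u z \<le> 0} z * ?d z" for z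
  proof (intro tendsto_mult_right)
    show "(\<lambda>n. \<phi> n z) \<longlonglongrightarrow> indicator {z. u z \<le> 0} z"
    proof (cases "u z \<le> 0")
      case True then show ?thesis by (simp add: \<phi>_def)
    next
      case False
      then have "filterlim (\<lambda>n. 1 + real n * (max 0 (u z))\<^sup>2) at_top sequentially"
        by (intro filterlim_tendsto_add_at_top[OF tendsto_const]
            filterlim_at_top_mult_tendsto_pos[OF tendsto_const] filterlim_real_sequentially) auto
      then have "(\<lambda>n. \<phi> n z) \<longlonglongrightarrow> 0"
        unfolding \<phi>_def by (intro tendsto_divide_0[OF tendsto_const] filterlim_at_top_imp_at_infinity)
      then show ?thesis using False by simp
    qed
  qed
  have "(\<lambda>n. \<integral>z. \<phi> n z * ?d z \<partial>lebesgue) \<longlonglongrightarrow> (\<integral>z. indicator {z. u z \<le> 0} z * ?d z \<partial>lebesgue)"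
  proof (rule integral_dominated_convergence)
    show "integrable lebesgue (\<lambda>z. \<bar>?d z\<bar>)" using d by (rule integrable_abs)
    show "(\<lambda>z. \<phi> n z * ?d z) \<in> borel_measurable lebesgue" for n
      using \<phi>d[of n] by (simp add: measurable_completion)
    then show "(\<lambda>z. indicator {z. u z \<le> 0} z * ?d z) \<in> borel_measurable lebesgue"
      by (rule borel_measurable_LIMSEQ_real[rotated]) (rule lim)
  qed (use lim \<phi>d_le in \<open>auto simp del: split_paired_All\<close>)
  moreover have "(\<integral>z. \<phi> n z * ?d z \<partial>lebesgue) \<le> 0" for n
  proof -
    let ?w = "\<lambda>z. indicator halfspace z * divergence halfspace (\<lambda>z. \<phi> n z *\<^sub>R \<zeta> z) z"
    have "(\<integral>z. \<phi> n z * ?d z \<partial>lebesgue) \<le> (\<integral>z. ?w z \<partial>lebesgue)"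
    proof (rule integral_mono)
      show "integrable lebesgue (\<lambda>z. \<phi> n z * ?d z)"
        by (rule Bochner_Integration.integrable_bound[OF d])
          (use \<phi>d[of n] \<phi>d_le in \<open>auto simp: measurable_completion simp del: split_paired_All\<close>)
      show "integrable lebesgue ?w"
        using W(1)[of n] K(3) by (intro divergence_integrable) auto
      show "\<phi> n z * ?d z \<le> ?w z" for z
      proof (cases "z \<in> halfspace")
        case True
        have "divergence halfspace (\<lambda>z. \<phi> n z *\<^sub>R \<zeta> z) z = \<phi> n z * divergence halfspace \<zeta> z + D\<phi> n z (\<zeta> z)"
          using W(2)[of n z] K(3) True by (simp add: divergence_def)
        moreover have "0 \<le> D\<phi> n z (\<zeta> z)"
          using le[OF True] pos[of n z]
          by (auto simp: D\<phi>_def intro!: divide_nonpos_nonneg mult_nonneg_nonpos)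
        ultimately show ?thesis using True by simp
      qed simp
    qed
    also have "\<dots> = 0"
      using integral_divergence_eq_0[of "\<lambda>z. \<phi> n z *\<^sub>R \<zeta> z"] W(1)[of n] K(3) bdy
      by (simp add: set_lebesgue_integral_def)
    finally show ?thesis .
  qed
  ultimately have "(\<integral>z. indicator {z. u z \<le> 0} z * ?d z \<partial>lebesgue) \<le> 0"
    by (intro LIMSEQ_le_const2) auto
  then show ?thesis by (simp add: set_lebesgue_integral_def mult_ac)
qed

section \<open>Cutoff functions\<close>

lemma C1_on_subset: "C1_on S f D \<Longrightarrow> T \<subseteq> S \<Longrightarrow> C1_on T f D"
  unfolding C1_on_def by (meson continuous_on_subset has_derivative_subset subsetD)

text \<open>
  A finite sum \<open>S\<close> of $C^1$ bumps over a cover of \<open>K\<close> by balls is bounded below by some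
  \<open>\<delta> > 0\<close> on \<open>K\<close>. Composing it with a $C^1$ function that vanishes at 0 and is
  constantly 1 from \<open>\<delta>\<close> on gives the cutoff; since the outer function is flat at
  \<open>\<delta>\<close>, the derivative vanishes on all of \<open>K\<close>, not only in its interior.
\<close>

lemma C1_cutoff_exists:
  fixes K :: "'a::euclidean_space set"
  assumes K: "compact K" and T: "open T" "K \<subseteq> T"
  obtains \<eta> :: "'a \<Rightarrow> real" and D\<eta> C where "C1_on UNIV \<eta> D\<eta>" "compact C" "C \<subseteq> T"
    "\<And>z. z \<notin> C \<Longrightarrow> \<eta> z = 0" "\<And>z. 0 \<le> \<eta> z" "\<And>z. \<eta> z \<le> 1"
    "\<And>z. z \<in> K \<Longrightarrow> \<eta> z = 1" "\<And>z. z \<in> K \<Longrightarrow> D\<eta> z = (\<lambda>v. 0)"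
proof -
  have "\<exists>r>0. cball p r \<subseteq> T" if "p \<in> K" for p
    using that T open_contains_cball by (metis subsetD)
  then obtain r where r: "\<And>p. p \<in> K \<Longrightarrow> 0 < r p" "\<And>p. p \<in> K \<Longrightarrow> cball p (r p) \<subseteq> T" by metis
  have "K \<subseteq> (\<Union>p\<in>K. ball p (r p))" using r(1) by auto
  then obtain F where F: "F \<subseteq> K" "finite F" "K \<subseteq> (\<Union>p\<in>F. ball p (r p))"
    using compactE_image[OF K, of K "\<lambda>p. ball p (r p)"] by (metis open_ball)
  define h where "h = (\<lambda>p z. (r p)\<^sup>2 - (z - p) \<bullet> (z - p))"
  define S where "S = (\<lambda>z. \<Sum>p\<in>F. (max 0 (h p z))\<^sup>2)"
  define DS where "DS = (\<lambda>z v. \<Sum>p\<in>F. 2 * max 0 (h p z) * (- (2 * ((z - p) \<bullet> v))))"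
  have h_deriv: "(h p has_derivative (\<lambda>v. - (2 * ((z - p) \<bullet> v)))) (at z)" for p z
    unfolding h_def by (auto intro!: derivative_eq_intros simp: fun_eq_iff inner_commute)
  have S_deriv: "(S has_derivative DS z) (at z)" for z
    unfolding S_def DS_def by (intro has_derivative_sum has_derivative_max_0_squared h_deriv)
  have h_pos: "0 < h p z \<longleftrightarrow> z \<in> ball p (r p)" if "p \<in> F" for p z
  proof -
    have "0 < r p" using r F that by blast
    moreover have "h p z = (r p)\<^sup>2 - (dist p z)\<^sup>2"
      by (simp add: h_def dist_norm norm_minus_commute power2_norm_eq_inner[symmetric])
    ultimately show ?thesis
      by (auto intro: power2_less_imp_less power_strict_mono)
  qed
  have S_nonneg: "0 \<le> S z" for z by (simp add: S_def sum_nonneg)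
  have S_pos: "0 < S z" if z: "z \<in> K" for z
  proof -
    obtain p where p: "p \<in> F" "z \<in> ball p (r p)" using F(3) z by blast
    then have "0 < h p z" using h_pos by blast
    then have "0 < (max 0 (h p z))\<^sup>2" by simp
    then show ?thesis
      unfolding S_def by (rule sum_pos2[OF F(2) p(1)]) simp
  qed
  have S_cont: "continuous_on A S" for A
    using S_deriv by (meson continuous_at_imp_continuous_on has_derivative_continuous)
  obtain \<delta> where \<delta>: "0 < \<delta>" "\<And>z. z \<in> K \<Longrightarrow> \<delta> \<le> S z"
  proof (cases "K = {}")
    case True then show ?thesis using that[of 1] by simp
  next
    case False
    then show ?thesis
      using continuous_attains_inf[OF K _ S_cont] S_pos that by blast
  qed
  define \<eta> where "\<eta> = (\<lambda>z. 1 - (max 0 (1 - S z / \<delta>))\<^sup>2)"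
  define D\<eta> where "D\<eta> = (\<lambda>z v. - (2 * max 0 (1 - S z / \<delta>) * (- (DS z v / \<delta>))))"
  show ?thesis
  proof
    have "(\<eta> has_derivative D\<eta> z) (at z)" for z
    proof -
      have "((\<lambda>z. 1 - S z / \<delta>) has_derivative (\<lambda>v. - (DS z v / \<delta>))) (at z)"
        using \<delta>(1) by (auto intro!: derivative_eq_intros S_deriv)
      from has_derivative_diff[OF has_derivative_const has_derivative_max_0_squared[OF this]]
      show ?thesis by (simp add: \<eta>_def D\<eta>_def)
    qed
    moreover have "continuous_on UNIV (\<lambda>z. D\<eta> z v)" for v
      unfolding D\<eta>_def DS_def h_def by (intro continuous_intros S_cont) (use \<delta>(1) in auto)
    ultimately show "C1_on UNIV \<eta> D\<eta>" by (simp add: C1_on_def)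
    show "compact (\<Union>p\<in>F. cball p (r p))" by (rule compact_UN[OF F(2)]) simp
    show "(\<Union>p\<in>F. cball p (r p)) \<subseteq> T" using r(2) F(1) by blast
    show "\<eta> z = 0" if z: "z \<notin> (\<Union>p\<in>F. cball p (r p))" for z
    proof -
      have "max 0 (h p z) = 0" if p: "p \<in> F" for p
      proof -
        have "z \<notin> ball p (r p)" using z p ball_subset_cball by blast
        then have "\<not> 0 < h p z" using h_pos[OF p] by blast
        then show ?thesis by simp
      qed
      then show ?thesis by (simp add: \<eta>_def S_def)
    qed
    show "0 \<le> \<eta> z" for z
      using S_nonneg[of z] \<delta>(1) by (simp add: \<eta>_def max_def power_le_one)
    show "\<eta> z \<le> 1" for z by (simp add: \<eta>_def)
    show "\<eta> z = 1" "D\<eta> z = (\<lambda>v. 0)" if z: "z \<in> K" for z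
    proof -
      have "max 0 (1 - S z / \<delta>) = 0" using \<delta>(1) \<delta>(2)[OF z] by (simp add: field_simps)
      then show "\<eta> z = 1" "D\<eta> z = (\<lambda>v. 0)" by (simp_all add: \<eta>_def D\<eta>_def fun_eq_iff)
    qed
  qed
qed

section \<open>The calibrating field\<close>

text \<open>
  For \<open>k = \<kappa>\<^sup>2\<close> this is a quarter of the gradient of $y^4 - \kappa^2 |x|^4$.
\<close>

definition quartic_gradient :: "real \<Rightarrow> (real ^ 'm) \<times> real \<Rightarrow> (real ^ 'm) \<times> real" where
  "quartic_gradient k z = (- (k * (fst z \<bullet> fst z)) *\<^sub>R fst z, snd z ^ 3)"

text \<open>
  The squared length of \<open>quartic_gradient k z\<close>, as a polynomial.
\<close>

definition quartic_gradient_sq :: "real \<Rightarrow> (real ^ 'm) \<times> real \<Rightarrow> real" where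
  "quartic_gradient_sq k z = k\<^sup>2 * (fst z \<bullet> fst z) ^ 3 + snd z ^ 6"

lemma norm_quartic_gradient: "norm (quartic_gradient k z) = sqrt (quartic_gradient_sq k z)"
  by (simp add: norm_eq_sqrt_inner quartic_gradient_def quartic_gradient_sq_def inner_prod_def
      power2_eq_square power3_eq_cube mult_ac eval_nat_numeral)

lemma snd_le_quartic_gradient_sq: "snd z ^ 6 \<le> quartic_gradient_sq k z"
  by (simp add: quartic_gradient_sq_def)

definition D_quartic_gradient :: "real \<Rightarrow> (real ^ 'm) \<times> real \<Rightarrow> (real ^ 'm) \<times> real \<Rightarrow> (real ^ 'm) \<times> real" where
  "D_quartic_gradient k z v =
     (- (k * (2 * (fst z \<bullet> fst v))) *\<^sub>R fst z - (k * (fst z \<bullet> fst z)) *\<^sub>R fst v, 3 * (snd z)\<^sup>2 * snd v)"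

lemma C1_on_quartic_gradient: "C1_on S (quartic_gradient k) (D_quartic_gradient k)"
  unfolding C1_on_def quartic_gradient_def D_quartic_gradient_def
  by (auto intro!: derivative_eq_intros continuous_intros simp: inner_commute algebra_simps fun_eq_iff)

lemma divergence_quartic_gradient:
  fixes z :: "(real ^ 'm) \<times> real"
  shows "(\<Sum>b\<in>Basis. D_quartic_gradient k z b \<bullet> b) =
    3 * (snd z)\<^sup>2 - k * (real CARD('m) + 2) * (fst z \<bullet> fst z)"
proof -
  have "(\<Sum>b\<in>Basis. D_quartic_gradient k z b \<bullet> b) =
      (\<Sum>i\<in>Basis. - (2 * k * ((fst z \<bullet> i) * (fst z \<bullet> i))) - k * (fst z \<bullet> fst z)) + 3 * (snd z)\<^sup>2"
    unfolding Basis_prod_def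
    by (subst sum.union_disjoint)
      (auto simp: sum.reindex inj_on_def D_quartic_gradient_def inner_prod_def inner_diff_left mult_ac)
  also have "\<dots> = 3 * (snd z)\<^sup>2 - 2 * k * (fst z \<bullet> fst z) - real CARD('m) * (k * (fst z \<bullet> fst z))"
    by (simp add: sum_subtractf sum_negf euclidean_inner[of "fst z" "fst z"] flip: sum_distrib_left)
  finally show ?thesis by (simp add: algebra_simps)
qed

definition calibration_factor :: "real \<Rightarrow> real \<Rightarrow> (real ^ 'm) \<times> real \<Rightarrow> real" where
  "calibration_factor \<alpha> k z = snd z powr \<alpha> / sqrt (quartic_gradient_sq k z)"

definition D_calibration_factor :: "real \<Rightarrow> real \<Rightarrow> (real ^ 'm) \<times> real \<Rightarrow> (real ^ 'm) \<times> real \<Rightarrow> real" where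
  "D_calibration_factor \<alpha> k z v =
     \<alpha> * snd z powr (\<alpha> - 1) * snd v / sqrt (quartic_gradient_sq k z) -
     snd z powr \<alpha> * (3 * k\<^sup>2 * (fst z \<bullet> fst z)\<^sup>2 * (fst z \<bullet> fst v) + 3 * snd z ^ 5 * snd v) /
       sqrt (quartic_gradient_sq k z) ^ 3"

text \<open>
  A power of $y$ absorbs the vanishing of $|\nabla u|$ at the origin, since $|\nabla u|$ is at least a
  multiple of $y^3$. Thus the origin needs no separate treatment from the other points with $y = 0$.
\<close>

lemma powr_div_sqrt_le:
  assumes "0 < y" "y ^ 6 \<le> Q"
  shows "y powr a / sqrt Q ^ n \<le> y powr (a - 3 * real n)"
proof -
  have Q: "0 < Q" using assms by (meson less_le_trans zero_less_power)
  have "y ^ 3 \<le> sqrt Q" using assms by (intro real_le_rsqrt) (simp flip: power_mult)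
  then have "y powr (3 * real n) \<le> sqrt Q ^ n"
    using assms power_mono[of "y ^ 3" "sqrt Q" n] powr_realpow[of y "3 * n"] by (simp add: power_mult)
  then have "y powr a / sqrt Q ^ n \<le> y powr a / y powr (3 * real n)"
    using assms(1) Q by (intro divide_left_mono mult_pos_pos) auto
  then show ?thesis by (simp add: powr_diff)
qed

text \<open>
  At points with $y = 0$ the factor is bounded by $y^{\alpha - 3}$, which is quadratically small, so that
  the derivative is 0 there; the derivative at nearby points is bounded by $y^{\alpha-4}$ and
  $y^{\alpha-9}$ times continuous functions, so that it tends to 0. The exponent 9 belongs to the cube of
  $|\nabla u|$ in the denominator of the derivative.
\<close>

lemma C1_on_calibration_factor:
  assumes "9 < \<alpha>"
  shows "C1_on halfspace (calibration_factor \<alpha> k :: (real ^ 'm) \<times> real \<Rightarrow> real) (D_calibration_factor \<alpha> k)"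
  unfolding C1_on_def continuous_on_eq_continuous_within
proof (intro conjI ballI allI)
  fix z v :: "(real ^ 'm) \<times> real" assume z: "z \<in> halfspace"
  have Qpos: "0 < quartic_gradient_sq k w" if "0 < snd w" for w :: "(real ^ 'm) \<times> real"
    using snd_le_quartic_gradient_sq[of w k] that by (simp add: less_le_trans[of 0 "snd w ^ 6"])
  have Qcont: "continuous_on A (quartic_gradient_sq k)" for A :: "((real ^ 'm) \<times> real) set"
    unfolding quartic_gradient_sq_def by (intro continuous_intros)
  have Qd: "(quartic_gradient_sq k has_derivative
      (\<lambda>v. 6 * k\<^sup>2 * (fst w \<bullet> fst w)\<^sup>2 * (fst w \<bullet> fst v) + 6 * snd w ^ 5 * snd v)) (at w)" for w :: "(real ^ 'm) \<times> real"
    unfolding quartic_gradient_sq_def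
    by (auto intro!: derivative_eq_intros simp: inner_commute algebra_simps fun_eq_iff power2_eq_square)
  have op: "open {z :: (real ^ 'm) \<times> real. 0 < snd z}"
    by (intro open_Collect_less continuous_intros)
  show "(calibration_factor \<alpha> k has_derivative D_calibration_factor \<alpha> k z) (at z within halfspace)"
  proof (cases "snd z = 0")
    case False
    then have y: "0 < snd z" using z by simp
    have "((\<lambda>y. y powr \<alpha>) has_real_derivative \<alpha> * snd z powr (\<alpha> - 1)) (at (snd z))"
      using y by (rule has_real_derivative_powr)
    then have d1: "((\<lambda>z. snd z powr \<alpha>) has_derivative (\<lambda>v. \<alpha> * snd z powr (\<alpha> - 1) * snd v)) (at z)"
      by (rule DERIV_compose_FDERIV[THEN has_derivative_eq_rhs]) (auto intro!: derivative_eq_intros)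
    have "((\<lambda>t. 1 / sqrt t) has_real_derivative - 1 / (2 * sqrt t ^ 3)) (at t)" if "0 < t" for t
      using that by (auto intro!: derivative_eq_intros simp: power2_eq_square power3_eq_cube divide_simps)
    from DERIV_compose_FDERIV[OF this[OF Qpos[OF y]] Qd]
    have d2: "((\<lambda>z. 1 / sqrt (quartic_gradient_sq k z)) has_derivative
      (\<lambda>v. - (3 * k\<^sup>2 * (fst z \<bullet> fst z)\<^sup>2 * (fst z \<bullet> fst v) + 3 * snd z ^ 5 * snd v) / sqrt (quartic_gradient_sq k z) ^ 3)) (at z)"
      by (rule has_derivative_eq_rhs) (use Qpos[OF y] in \<open>auto simp: fun_eq_iff divide_simps\<close>)
    have "(calibration_factor \<alpha> k has_derivative D_calibration_factor \<alpha> k z) (at z)"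
      using has_derivative_mult[OF d1 d2]
      by (simp add: calibration_factor_def[abs_def] D_calibration_factor_def[abs_def] algebra_simps diff_divide_distrib add_divide_distrib)
    then show ?thesis by (rule has_derivative_at_withinI)
  next
    case True
    have "norm (calibration_factor \<alpha> k w) \<le> norm (w - z) ^ 2" if w: "w \<in> halfspace" "dist w z < 1" for w :: "(real ^ 'm) \<times> real"
    proof (cases "snd w = 0")
      case False
      then have y: "0 < snd w" using w by simp
      have "snd w = \<bar>snd (w - z)\<bar>" using True y by simp
      also have "\<dots> \<le> norm (w - z)" using norm_snd_le[of "snd (w - z)" "fst (w - z)"] by (simp only: prod.collapse real_norm_def)
      finally have le: "snd w \<le> norm (w - z)" .
      have "calibration_factor \<alpha> k w \<le> snd w powr (\<alpha> - 3)"
        using powr_div_sqrt_le[OF y snd_le_quartic_gradient_sq, of \<alpha> k 1] by (simp add: calibration_factor_def)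
      also have "\<dots> \<le> snd w powr 2"
        using y le w(2) assms by (intro powr_mono') (auto simp: dist_norm)
      also have "\<dots> = snd w ^ 2" using y by (simp add: powr_numeral)
      also have "\<dots> \<le> norm (w - z) ^ 2" using y le by (intro power_mono) auto
      finally show ?thesis using y Qpos[OF y] by (simp add: calibration_factor_def)
    qed (simp add: calibration_factor_def)
    note bd = this
    have "((\<lambda>w. (calibration_factor \<alpha> k w - calibration_factor \<alpha> k z - 0) /\<^sub>R norm (w - z)) \<longlongrightarrow> 0) (at z within halfspace)"
    proof (rule Lim_null_comparison)
      show "\<forall>\<^sub>F w in at z within halfspace.
          norm ((calibration_factor \<alpha> k w - calibration_factor \<alpha> k z - 0) /\<^sub>R norm (w - z)) \<le> norm (w - z)"
        unfolding eventually_at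
      proof (intro exI[of _ 1] conjI ballI impI)
        fix w :: "(real ^ 'm) \<times> real" assume w: "w \<in> halfspace" "w \<noteq> z \<and> dist w z < 1"
        show "norm ((calibration_factor \<alpha> k w - calibration_factor \<alpha> k z - 0) /\<^sub>R norm (w - z)) \<le> norm (w - z)"
        proof -
          have "calibration_factor \<alpha> k z = 0" using True by (simp add: calibration_factor_def)
          moreover have "0 < norm (w - z)" using w by simp
          ultimately show ?thesis
            using bd[of w] w by (simp add: inverse_eq_divide pos_divide_le_eq power2_eq_square)
        qed
      qed simp
      show "((\<lambda>w. norm (w - z)) \<longlongrightarrow> 0) (at z within halfspace)"
        by (auto intro!: tendsto_eq_intros)
    qed
    moreover have "D_calibration_factor \<alpha> k z = (\<lambda>v. 0)"
      using True by (simp add: D_calibration_factor_def fun_eq_iff)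
    ultimately show ?thesis
      by (simp add: has_derivative_within bounded_linear_zero divide_inverse_commute)
  qed
  show "continuous (at z within halfspace) (\<lambda>z. D_calibration_factor \<alpha> k z v)"
  proof (cases "snd z = 0")
    case False
    then have y: "0 < snd z" using z by simp
    let ?S = "{z :: (real ^ 'm) \<times> real. 0 < snd z}"
    have c1: "continuous_on ?S (\<lambda>z. snd z powr a)" for a
      by (intro continuous_on_powr continuous_on_snd continuous_on_id continuous_on_const) auto
    have c2: "continuous_on ?S (\<lambda>z. sqrt (quartic_gradient_sq k z))"
      by (intro continuous_on_real_sqrt Qcont)
    have nz: "\<forall>z\<in>?S. sqrt (quartic_gradient_sq k z) \<noteq> 0" "\<forall>z\<in>?S. sqrt (quartic_gradient_sq k z) ^ 3 \<noteq> 0"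
      using Qpos by (simp_all del: split_paired_All add: less_imp_neq[symmetric])
    have "continuous_on ?S (\<lambda>z. D_calibration_factor \<alpha> k z v)"
      unfolding D_calibration_factor_def by (intro continuous_on_diff continuous_on_divide continuous_on_mult continuous_on_add continuous_on_power
          continuous_on_inner continuous_on_fst continuous_on_snd continuous_on_id continuous_on_const c1 c2 nz)
    then show ?thesis
      using y continuous_on_eq_continuous_at[OF op] continuous_at_imp_continuous_at_within by blast
  next
    case True
    let ?M = "\<lambda>w :: (real ^ 'm) \<times> real. \<alpha> * snd w powr (\<alpha> - 4) * \<bar>snd v\<bar> +
        snd w powr (\<alpha> - 9) * \<bar>3 * k\<^sup>2 * (fst w \<bullet> fst w)\<^sup>2 * (fst w \<bullet> fst v) + 3 * snd w ^ 5 * snd v\<bar>"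
    have "((\<lambda>w. D_calibration_factor \<alpha> k w v) \<longlongrightarrow> 0) (at z within halfspace)"
    proof (rule Lim_null_comparison)
      show "\<forall>\<^sub>F w in at z within halfspace. norm (D_calibration_factor \<alpha> k w v) \<le> ?M w"
        unfolding eventually_at
      proof (intro exI[of _ 1] conjI ballI impI)
        fix w :: "(real ^ 'm) \<times> real" assume w: "w \<in> halfspace"
        show "norm (D_calibration_factor \<alpha> k w v) \<le> ?M w"
        proof (cases "snd w = 0")
          case True then show ?thesis by (simp add: D_calibration_factor_def)
        next
          case False
          then have y: "0 < snd w" using w by simp
          let ?q = "sqrt (quartic_gradient_sq k w)"
          let ?L = "3 * k\<^sup>2 * (fst w \<bullet> fst w)\<^sup>2 * (fst w \<bullet> fst v) + 3 * snd w ^ 5 * snd v"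
          have "norm (D_calibration_factor \<alpha> k w v) \<le>
              \<bar>\<alpha> * snd w powr (\<alpha> - 1) * snd v / ?q\<bar> + \<bar>snd w powr \<alpha> * ?L / ?q ^ 3\<bar>"
            unfolding D_calibration_factor_def real_norm_def by (rule abs_triangle_ineq4)
          also have "\<dots> = \<alpha> * (snd w powr (\<alpha> - 1) / ?q ^ 1) * \<bar>snd v\<bar> + (snd w powr \<alpha> / ?q ^ 3) * \<bar>?L\<bar>"
            using assms Qpos[OF y] by (simp add: abs_mult)
          also have "\<dots> \<le> \<alpha> * snd w powr (\<alpha> - 1 - 3 * real 1) * \<bar>snd v\<bar> + snd w powr (\<alpha> - 3 * real 3) * \<bar>?L\<bar>"
            using assms by (intro add_mono mult_right_mono mult_left_mono powr_div_sqrt_le y snd_le_quartic_gradient_sq) auto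
          finally show ?thesis by simp
        qed
      qed simp
      have "((\<lambda>w. snd w powr a) \<longlongrightarrow> 0) (at z within halfspace)" if "0 < a" for a
      proof -
        have "((\<lambda>w. snd w powr a) \<longlongrightarrow> snd z powr a) (at z within halfspace)"
          using that True
          by (intro tendsto_powr2 tendsto_intros) (auto simp: eventually_at intro!: exI[of _ 1])
        then show ?thesis using True by simp
      qed
      note powr_lim = this
      have "(?M \<longlongrightarrow> \<alpha> * 0 * \<bar>snd v\<bar> +
          0 * \<bar>3 * k\<^sup>2 * (fst z \<bullet> fst z)\<^sup>2 * (fst z \<bullet> fst v) + 3 * snd z ^ 5 * snd v\<bar>) (at z within halfspace)"
        using assms by (intro tendsto_add tendsto_mult tendsto_const powr_lim tendsto_rabs tendsto_inner
            tendsto_power tendsto_fst tendsto_snd tendsto_ident_at) auto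
      then show "(?M \<longlongrightarrow> 0) (at z within halfspace)" by simp
    qed
    moreover have "D_calibration_factor \<alpha> k z v = 0"
      using True by (simp add: D_calibration_factor_def)
    ultimately show ?thesis by (simp add: continuous_within)
  qed
qed

text \<open>
  For \<open>k = \<kappa>\<^sup>2\<close> this is the field $\xi = y^\alpha \nabla u / |\nabla u|$. Its value
  at the origin, where the quotient degenerates, is the continuous extension 0.
\<close>

definition calibration :: "real \<Rightarrow> real \<Rightarrow> (real ^ 'm) \<times> real \<Rightarrow> (real ^ 'm) \<times> real" where
  "calibration \<alpha> k z = calibration_factor \<alpha> k z *\<^sub>R quartic_gradient k z"

definition D_calibration :: "real \<Rightarrow> real \<Rightarrow> (real ^ 'm) \<times> real \<Rightarrow> (real ^ 'm) \<times> real \<Rightarrow> (real ^ 'm) \<times> real" where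
  "D_calibration \<alpha> k z v = calibration_factor \<alpha> k z *\<^sub>R D_quartic_gradient k z v +
     D_calibration_factor \<alpha> k z v *\<^sub>R quartic_gradient k z"

lemma C1_on_calibration:
  assumes "9 < \<alpha>"
  shows "C1_on halfspace (calibration \<alpha> k :: (real ^ 'm) \<times> real \<Rightarrow> _) (D_calibration \<alpha> k)"
proof -
  note f = C1_on_calibration_factor[OF assms, of k]
  note P = C1_on_quartic_gradient[of halfspace k]
  show ?thesis
    using f P unfolding C1_on_def calibration_def[abs_def] D_calibration_def
    by (auto intro!: derivative_eq_intros continuous_intros C1_onD(3)[OF f] C1_onD(3)[OF P])
qed

lemma calibration_factor_nonneg: "0 \<le> calibration_factor \<alpha> k z"
proof -
  have "0 \<le> quartic_gradient_sq k z" by (simp add: quartic_gradient_sq_def)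
  then show ?thesis by (simp add: calibration_factor_def)
qed

lemma calibration_eq_0: "snd z = 0 \<Longrightarrow> calibration \<alpha> k z = 0"
  by (simp add: calibration_def calibration_factor_def)

lemma norm_calibration_le: "norm (calibration \<alpha> k z) \<le> snd z powr \<alpha>"
  using calibration_factor_nonneg[of \<alpha> k z]
  by (simp add: calibration_def norm_quartic_gradient) (simp add: calibration_factor_def)

lemma inner_calibration:
  "quartic_gradient k z \<bullet> calibration \<alpha> k z = snd z powr \<alpha> * norm (quartic_gradient k z)"
proof -
  have "0 \<le> quartic_gradient_sq k z" by (simp add: quartic_gradient_sq_def)
  then have "quartic_gradient k z \<bullet> quartic_gradient k z = norm (quartic_gradient k z) * norm (quartic_gradient k z)"
    by (simp add: norm_eq_sqrt_inner)
  then show ?thesis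
    by (simp add: calibration_def calibration_factor_def flip: norm_quartic_gradient)
qed

text \<open>
  For \<open>n = 1\<close> and \<open>t = 1\<close> the cubic has its minimum over \<open>Y \<ge> 0\<close> at $1 + \sqrt 2$. Rounding
  this to 5/2 gives the square in the decomposition below, which leaves a nonnegative remainder when the
  constant term is 13.
\<close>

lemma cubic_factor_nonneg:
  fixes Y t a n :: real
  assumes "0 \<le> Y" "0 \<le> t" "13 \<le> a" "1 \<le> n"
  shows "0 \<le> n * Y ^ 3 - 3 * t * Y\<^sup>2 - 3 * t\<^sup>2 * Y + a * t ^ 3"
proof -
  have "0 \<le> (Y - 5 / 2 * t)\<^sup>2 * (Y + 2 * t) + 3 / 4 * (t\<^sup>2 * Y) + 1 / 2 * t ^ 3"
    using assms by (intro add_nonneg_nonneg mult_nonneg_nonneg) auto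
  also have "\<dots> = 1 * Y ^ 3 - 3 * t * Y\<^sup>2 - 3 * t\<^sup>2 * Y + 13 * t ^ 3"
    by (simp add: power2_eq_square power3_eq_cube field_simps)
  also have "\<dots> \<le> n * Y ^ 3 - 3 * t * Y\<^sup>2 - 3 * t\<^sup>2 * Y + a * t ^ 3"
    using assms by (intro add_mono diff_mono mult_right_mono) auto
  finally show ?thesis .
qed

text \<open>
  With $Y = y^2$ and $t = \kappa|x|^2$ the numerator of the divergence is a polynomial in $Y$ and $t$. It
  vanishes for $Y = t$, because the boundary of the cone is stationary for the weighted perimeter when
  $\alpha = (m-1)\kappa$, and the cofactor is the cubic of \<open>cubic_factor_nonneg\<close>.
\<close>

lemma divergence_calibration_sign:
  fixes z :: "(real ^ 'm) \<times> real"
  assumes m: "2 \<le> CARD('m)" and \<alpha>: "13 \<le> \<alpha>" and z: "0 \<le> snd z"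
  defines "\<kappa> \<equiv> \<alpha> / (real CARD('m) - 1)"
  obtains c where "0 \<le> c"
    "(\<Sum>b\<in>Basis. D_calibration \<alpha> (\<kappa>\<^sup>2) z b \<bullet> b) = c * ((snd z)\<^sup>2 - \<kappa> * (fst z \<bullet> fst z))"
proof (cases "snd z = 0")
  case True
  then show ?thesis
    by (intro that[of 0]) (simp_all add: D_calibration_def calibration_factor_def D_calibration_factor_def)
next
  case False
  then have snd_pos: "0 < snd z" using z by simp
  define n where "n = real CARD('m) - 1"
  define y where "y = snd z"
  define \<rho> where "\<rho> = fst z \<bullet> fst z"
  define q where "q = sqrt (quartic_gradient_sq (\<kappa>\<^sup>2) z)"
  have n: "1 \<le> n" using m by (simp add: n_def)
  have \<kappa>: "\<alpha> = n * \<kappa>" "0 \<le> \<kappa>" using n \<alpha> by (simp_all add: \<kappa>_def n_def)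
  have \<rho>: "0 \<le> \<rho>" by (simp add: \<rho>_def)
  have Qpos: "0 < quartic_gradient_sq (\<kappa>\<^sup>2) z"
    using snd_le_quartic_gradient_sq[of z "\<kappa>\<^sup>2"] snd_pos by (simp add: less_le_trans[of 0 "snd z ^ 6"])
  then have q: "0 < q" "q\<^sup>2 = \<kappa> ^ 4 * \<rho> ^ 3 + y ^ 6"
    by (simp_all add: q_def quartic_gradient_sq_def \<rho>_def y_def flip: power_mult)
  have y': "0 < y" "y powr (\<alpha> - 1) = y powr \<alpha> / y"
    using snd_pos by (simp_all add: y_def powr_diff)
  let ?R = "n * (y\<^sup>2) ^ 3 - 3 * (\<kappa> * \<rho>) * (y\<^sup>2)\<^sup>2 - 3 * (\<kappa> * \<rho>)\<^sup>2 * y\<^sup>2 + \<alpha> * (\<kappa> * \<rho>) ^ 3"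
  have "(\<Sum>b\<in>Basis. D_calibration \<alpha> (\<kappa>\<^sup>2) z b \<bullet> b) =
      calibration_factor \<alpha> (\<kappa>\<^sup>2) z * (\<Sum>b\<in>Basis. D_quartic_gradient (\<kappa>\<^sup>2) z b \<bullet> b) +
      D_calibration_factor \<alpha> (\<kappa>\<^sup>2) z (quartic_gradient (\<kappa>\<^sup>2) z)"
  proof -
    have "(calibration_factor \<alpha> (\<kappa>\<^sup>2) has_derivative D_calibration_factor \<alpha> (\<kappa>\<^sup>2) z) (at z within halfspace)"
      using C1_on_calibration_factor[of \<alpha> "\<kappa>\<^sup>2"] \<alpha> z by (intro C1_onD(1)) auto
    then have "linear (D_calibration_factor \<alpha> (\<kappa>\<^sup>2) z)" using has_derivative_linear by blast
    from linear_sum_Basis[OF this, of "quartic_gradient (\<kappa>\<^sup>2) z"] show ?thesis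
      by (simp add: D_calibration_def inner_add_left sum.distrib sum_distrib_left)
  qed
  also have "\<dots> = y powr \<alpha> / q * (3 * y\<^sup>2 - \<kappa>\<^sup>2 * (n + 3) * \<rho>) +
      (\<alpha> * (y powr \<alpha> / y) * y ^ 3 / q - y powr \<alpha> * (3 * y ^ 8 - 3 * \<kappa> ^ 6 * \<rho> ^ 4) / q ^ 3)"
  proof -
    have "3 * (\<kappa>\<^sup>2)\<^sup>2 * (fst z \<bullet> fst z)\<^sup>2 * (fst z \<bullet> fst (quartic_gradient (\<kappa>\<^sup>2) z)) +
        3 * snd z ^ 5 * snd (quartic_gradient (\<kappa>\<^sup>2) z) = 3 * y ^ 8 - 3 * \<kappa> ^ 6 * \<rho> ^ 4"
      by (simp add: quartic_gradient_def y_def \<rho>_def eval_nat_numeral)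
    then have "D_calibration_factor \<alpha> (\<kappa>\<^sup>2) z (quartic_gradient (\<kappa>\<^sup>2) z) =
        \<alpha> * (y powr \<alpha> / y) * y ^ 3 / q - y powr \<alpha> * (3 * y ^ 8 - 3 * \<kappa> ^ 6 * \<rho> ^ 4) / q ^ 3"
      unfolding D_calibration_factor_def q_def[symmetric]
      by (simp add: y'(2)[symmetric]) (simp add: quartic_gradient_def y_def)
    then show ?thesis
      by (simp add: divergence_quartic_gradient calibration_factor_def flip: q_def y_def \<rho>_def)
        (simp add: n_def add.commute)
  qed
  also have "\<dots> = y powr \<alpha> / q ^ 3 * (q\<^sup>2 * (3 * y\<^sup>2 - \<kappa>\<^sup>2 * (n + 3) * \<rho> + \<alpha> * y\<^sup>2) - (3 * y ^ 8 - 3 * \<kappa> ^ 6 * \<rho> ^ 4))"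
    using q(1) y'(1) by (simp add: divide_simps) (simp add: algebra_simps power2_eq_square power3_eq_cube)
  also have "\<dots> = y powr \<alpha> / q ^ 3 * (\<kappa> * (y\<^sup>2 - \<kappa> * \<rho>) * ?R)"
  proof -
    have "q\<^sup>2 * (3 * y\<^sup>2 - \<kappa>\<^sup>2 * (n + 3) * \<rho> + \<alpha> * y\<^sup>2) - (3 * y ^ 8 - 3 * \<kappa> ^ 6 * \<rho> ^ 4) = \<kappa> * (y\<^sup>2 - \<kappa> * \<rho>) * ?R"
      unfolding q(2) \<kappa>(1) by (simp add: algebra_simps eval_nat_numeral)
    then show ?thesis by simp
  qed
  also have "\<dots> = (y powr \<alpha> / q ^ 3 * \<kappa> * ?R) * ((snd z)\<^sup>2 - \<kappa> * (fst z \<bullet> fst z))"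
    by (simp add: y_def \<rho>_def)
  finally show ?thesis
    using cubic_factor_nonneg[of "y\<^sup>2" "\<kappa> * \<rho>" \<alpha> n] \<kappa>(2) \<rho> \<alpha> n q(1)
    by (intro that[of "y powr \<alpha> / q ^ 3 * \<kappa> * ?R"] mult_nonneg_nonneg divide_nonneg_nonneg) auto
qed

section \<open>Minimality of the cone\<close>

lemma C1c_fields_diff:
  fixes \<psi> \<phi> :: "(real ^ 'm) \<times> real \<Rightarrow> (real ^ 'm) \<times> real"
  assumes B: "openin (top_of_set halfspace) B" and \<psi>: "\<psi> \<in> C1c_fields B" and \<phi>: "\<phi> \<in> C1c_fields B"
  shows "(\<lambda>z. \<psi> z - \<phi> z) \<in> C1c_fields B"
    "\<And>z. z \<in> B \<Longrightarrow> divergence B (\<lambda>z. \<psi> z - \<phi> z) z = divergence B \<psi> z - divergence B \<phi> z"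
proof -
  obtain K where K: "compact K" "K \<subseteq> B" "\<And>z. z \<in> B - K \<Longrightarrow> \<psi> z = 0"
    using C1c_fields_support[OF \<psi>] by blast
  obtain L where L: "compact L" "L \<subseteq> B" "\<And>z. z \<in> B - L \<Longrightarrow> \<phi> z = 0"
    using C1c_fields_support[OF \<phi>] by blast
  have C1: "C1_on B (\<lambda>z. \<psi> z - \<phi> z)
      (\<lambda>z v. frechet_derivative \<psi> (at z within B) v - frechet_derivative \<phi> (at z within B) v)"
    using C1c_fields_C1_on[OF \<psi>] C1c_fields_C1_on[OF \<phi>] unfolding C1_on_def
    by (auto intro: has_derivative_diff continuous_on_diff)
  have KL: "compact (K \<union> L)" "K \<union> L \<subseteq> B" using K L by auto
  show "(\<lambda>z. \<psi> z - \<phi> z) \<in> C1c_fields B"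
    by (rule C1c_fieldsI[OF B C1 KL]) (use K(3) L(3) in auto)
  show "divergence B (\<lambda>z. \<psi> z - \<phi> z) z = divergence B \<psi> z - divergence B \<phi> z" if "z \<in> B" for z
    by (subst C1c_fieldsI(3)[OF B C1 KL _ that])
      (use K(3) L(3) in \<open>auto simp: divergence_def inner_diff_left sum_subtractf\<close>)
qed

lemma indicator_divergence_integrable:
  fixes \<psi> :: "(real ^ 'm) \<times> real \<Rightarrow> (real ^ 'm) \<times> real"
  assumes B: "openin (top_of_set halfspace) B" and \<psi>: "\<psi> \<in> C1c_fields B" and F: "F \<in> sets lebesgue"
  shows "set_integrable lebesgue B (\<lambda>z. indicator F z * divergence B \<psi> z)"
proof -
  note \<psi>' = zero_extension_C1c_fields[OF B \<psi>]
  have BH: "B \<subseteq> halfspace" using openin_imp_subset[OF B] .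
  have "integrable lebesgue (\<lambda>z. indicator F z *\<^sub>R
      (indicator halfspace z * divergence halfspace (\<lambda>z. if z \<in> B then \<psi> z else 0) z))"
    by (intro integrable_mult_indicator F divergence_integrable \<psi>'(1))
  also have "(\<lambda>z. indicator F z *\<^sub>R
      (indicator halfspace z * divergence halfspace (\<lambda>z. if z \<in> B then \<psi> z else 0) z)) =
    (\<lambda>z. indicator B z *\<^sub>R (indicator F z * divergence B \<psi> z))"
    using \<psi>'(2) BH by (auto simp: fun_eq_iff subset_iff split: split_indicator)
  finally show ?thesis by (simp add: set_integrable_def)
qed

lemma integral_zero_extension:
  fixes \<psi> :: "(real ^ 'm) \<times> real \<Rightarrow> (real ^ 'm) \<times> real"
  assumes B: "openin (top_of_set halfspace) B" and \<psi>: "\<psi> \<in> C1c_fields B"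
  shows "(LINT z:halfspace|lebesgue. f z * divergence halfspace (\<lambda>z. if z \<in> B then \<psi> z else 0) z) =
    (LINT z:B|lebesgue. f z * divergence B \<psi> z)"
  unfolding set_lebesgue_integral_def
  using zero_extension_C1c_fields(2)[OF B \<psi>] openin_imp_subset[OF B]
  by (intro Bochner_Integration.integral_cong) (auto simp: subset_iff split: split_indicator)

definition cone_function :: "real \<Rightarrow> (real ^ 'm) \<times> real \<Rightarrow> real" where
  "cone_function \<kappa> z = snd z ^ 4 - \<kappa>\<^sup>2 * (fst z \<bullet> fst z)\<^sup>2"

lemma C1_on_cone_function:
  "C1_on S (cone_function \<kappa>) (\<lambda>z v. 4 * (quartic_gradient (\<kappa>\<^sup>2) z \<bullet> v))"
  unfolding C1_on_def cone_function_def quartic_gradient_def inner_prod_def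
  by (auto intro!: derivative_eq_intros continuous_intros simp: inner_commute algebra_simps fun_eq_iff)

lemma cone_function_sign:
  assumes "0 \<le> \<kappa>"
  shows "cone_function \<kappa> z \<le> 0 \<longleftrightarrow> (snd z)\<^sup>2 \<le> \<kappa> * (fst z \<bullet> fst z)"
proof -
  have "cone_function \<kappa> z \<le> 0 \<longleftrightarrow> ((snd z)\<^sup>2)\<^sup>2 \<le> (\<kappa> * (fst z \<bullet> fst z))\<^sup>2"
    by (simp add: cone_function_def power_mult_distrib flip: power_mult)
  also have "\<dots> \<longleftrightarrow> (snd z)\<^sup>2 \<le> \<kappa> * (fst z \<bullet> fst z)"
    using assms by (intro power_mono_iff) auto
  finally show ?thesis .
qed

lemma alpha_cone_eq_sublevel:
  assumes "0 \<le> \<alpha>" "2 \<le> CARD('m)"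
  shows "(alpha_cone \<alpha> :: ((real ^ 'm) \<times> real) set) =
    halfspace \<inter> {z. cone_function (\<alpha> / (real CARD('m) - 1)) z \<le> 0}"
proof -
  let ?\<kappa> = "\<alpha> / (real CARD('m) - 1)"
  have \<kappa>: "0 \<le> ?\<kappa>" using assms by simp
  have "y \<le> sqrt ?\<kappa> * norm x \<longleftrightarrow> y\<^sup>2 \<le> ?\<kappa> * (x \<bullet> x)" if "0 \<le> y" for x :: "real ^ 'm" and y
  proof -
    have "y \<le> sqrt ?\<kappa> * norm x \<longleftrightarrow> y\<^sup>2 \<le> (sqrt ?\<kappa> * norm x)\<^sup>2"
      using that \<kappa> by (intro power_mono_iff[symmetric]) auto
    also have "(sqrt ?\<kappa> * norm x)\<^sup>2 = ?\<kappa> * (x \<bullet> x)"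
      using \<kappa> by (simp only: power_mult_distrib real_sqrt_pow2 power2_norm_eq_inner)
    finally show ?thesis .
  qed
  then show ?thesis
    by (auto simp: alpha_cone_def cone_function_sign[OF \<kappa>])
qed

text \<open>
  Among all fields bounded by $y^\alpha$ the calibration has the largest component along $\nabla u$.
  Hence \<open>\<psi> - \<eta> \<xi>\<close> points into the sublevel sets of \<open>u\<close> wherever \<open>\<eta> = 1\<close>, and
  elsewhere \<open>\<psi>\<close> vanishes and \<open>- \<eta> \<xi>\<close> does so.
\<close>

lemma sublevel_flux_le_calibration_flux:
  fixes B :: "((real ^ 'm) \<times> real) set"
  assumes \<alpha>: "9 < \<alpha>"
    and B: "openin (top_of_set halfspace) B"
    and \<psi>: "\<psi> \<in> C1c_fields B" "\<And>z. z \<in> B \<Longrightarrow> norm (\<psi> z) \<le> snd z powr \<alpha>"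
    and \<eta>: "(\<lambda>z. \<eta> z *\<^sub>R calibration \<alpha> (\<kappa>\<^sup>2) z) \<in> C1c_fields B" "\<And>z. 0 \<le> \<eta> z"
      "\<And>z. z \<in> B \<Longrightarrow> \<psi> z \<noteq> 0 \<Longrightarrow> \<eta> z = 1"
    and E: "E \<in> sets lebesgue" "E = halfspace \<inter> {z. cone_function \<kappa> z \<le> 0}"
  shows "(LINT z:B|lebesgue. indicator E z * divergence B \<psi> z) \<le>
    (LINT z:B|lebesgue. indicator E z * divergence B (\<lambda>z. \<eta> z *\<^sub>R calibration \<alpha> (\<kappa>\<^sup>2) z) z)"
proof -
  let ?\<phi> = "\<lambda>z. \<eta> z *\<^sub>R calibration \<alpha> (\<kappa>\<^sup>2) z"
  let ?\<zeta> = "\<lambda>z. if z \<in> B then \<psi> z - ?\<phi> z else 0"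
  have BH: "B \<subseteq> halfspace" using openin_imp_subset[OF B] .
  note diff = C1c_fields_diff[OF B \<psi>(1) \<eta>(1)]
  note int = indicator_divergence_integrable[OF B _ E(1)]
  have "(LINT z:B|lebesgue. indicator E z * divergence B \<psi> z) - (LINT z:B|lebesgue. indicator E z * divergence B ?\<phi> z)
      = (LINT z:B|lebesgue. indicator E z * divergence B \<psi> z - indicator E z * divergence B ?\<phi> z)"
    by (rule set_integral_diff(2)[symmetric]) (intro int \<psi>(1) \<eta>(1))+
  also have "\<dots> = (LINT z:B|lebesgue. indicator E z * divergence B (\<lambda>z. \<psi> z - ?\<phi> z) z)"
    unfolding set_lebesgue_integral_def using diff(2)
    by (intro Bochner_Integration.integral_cong) (auto split: split_indicator)
  also have "\<dots> = (LINT z:halfspace|lebesgue. indicator E z * divergence halfspace ?\<zeta> z)"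
    by (rule integral_zero_extension[OF B diff(1), symmetric])
  also have "\<dots> = (LINT z:halfspace|lebesgue. indicator {z. cone_function \<kappa> z \<le> 0} z * divergence halfspace ?\<zeta> z)"
    unfolding set_lebesgue_integral_def E(2)
    by (intro Bochner_Integration.integral_cong) (auto split: split_indicator)
  also have "\<dots> \<le> 0"
  proof (rule integral_divergence_sublevel_le_0[OF zero_extension_C1c_fields(1)[OF B diff(1)] _ C1_on_cone_function])
    show "?\<zeta> z = 0" if "snd z = 0" for z
      using \<psi>(2)[of z] that by (auto simp: calibration_eq_0)
    show "4 * (quartic_gradient (\<kappa>\<^sup>2) z \<bullet> ?\<zeta> z) \<le> 0" if "z \<in> halfspace" for z
    proof (cases "z \<in> B")
      case True
      let ?P = "quartic_gradient (\<kappa>\<^sup>2) z"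
      have "?P \<bullet> \<psi> z \<le> \<eta> z * (?P \<bullet> calibration \<alpha> (\<kappa>\<^sup>2) z)"
      proof (cases "\<psi> z = 0")
        case False
        have "?P \<bullet> \<psi> z \<le> norm ?P * norm (\<psi> z)" by (rule norm_cauchy_schwarz)
        also have "\<dots> \<le> norm ?P * snd z powr \<alpha>" using \<psi>(2)[OF True] by (intro mult_left_mono) auto
        finally show ?thesis
          using \<eta>(3)[OF True False] by (simp add: inner_calibration mult.commute)
      qed (simp add: inner_calibration \<eta>(2))
      then show ?thesis using True by (simp add: inner_diff_right)
    qed simp
  qed
  finally show ?thesis by simp
qed

lemma alpha_cone_closed:
  assumes "0 \<le> \<alpha>" "2 \<le> CARD('m)"
  shows "closed (alpha_cone \<alpha> :: ((real ^ 'm) \<times> real) set)"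
proof -
  have "closed {z :: (real ^ 'm) \<times> real. cone_function (\<alpha> / (real CARD('m) - 1)) z \<le> 0}"
    unfolding cone_function_def by (intro closed_Collect_le continuous_intros)
  then show ?thesis unfolding alpha_cone_eq_sublevel[OF assms] by (intro closed_Int closed_halfspace)
qed

lemma cutoff_calibration_exists:
  fixes B K :: "((real ^ 'm) \<times> real) set"
  assumes \<alpha>: "9 < \<alpha>" and B: "openin (top_of_set halfspace) B" and K: "compact K" "K \<subseteq> B"
  obtains \<eta> where "(\<lambda>z. \<eta> z *\<^sub>R calibration \<alpha> k z) \<in> C1c_fields B"
    "\<And>z. 0 \<le> \<eta> z" "\<And>z. \<eta> z \<le> 1" "\<And>z. z \<in> K \<Longrightarrow> \<eta> z = 1"
    "\<And>z. z \<in> K \<Longrightarrow> divergence B (\<lambda>z. \<eta> z *\<^sub>R calibration \<alpha> k z) z = (\<Sum>b\<in>Basis. D_calibration \<alpha> k z b \<bullet> b)"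
proof -
  obtain T where T: "open T" "B = halfspace \<inter> T" using B by (auto simp: openin_open)
  obtain \<eta> :: "(real ^ 'm) \<times> real \<Rightarrow> real" and D\<eta> C where \<eta>: "C1_on UNIV \<eta> D\<eta>" "compact C" "C \<subseteq> T"
    "\<And>z. z \<notin> C \<Longrightarrow> \<eta> z = 0" "\<And>z. 0 \<le> \<eta> z" "\<And>z. \<eta> z \<le> 1"
    "\<And>z. z \<in> K \<Longrightarrow> \<eta> z = 1" "\<And>z. z \<in> K \<Longrightarrow> D\<eta> z = (\<lambda>v. 0)"
    using C1_cutoff_exists[OF K(1) T(1)] K(2) T(2) by (metis (no_types, lifting) Int_subset_iff)
  have BH: "B \<subseteq> halfspace" using T(2) by blast
  have C: "compact (halfspace \<inter> C)" "halfspace \<inter> C \<subseteq> B"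
    using \<eta>(2,3) T(2) closed_halfspace by blast+
  note prod = C1c_fields_scaleR[OF B C1_on_subset[OF \<eta>(1) subset_UNIV]
      C1_on_subset[OF C1_on_calibration[OF \<alpha>, of k] BH] C]
  have 0: "\<eta> z = 0 \<or> calibration \<alpha> k z = 0" if "z \<in> B - halfspace \<inter> C" for z
    using that BH \<eta>(4) by blast
  show ?thesis
  proof (rule that)
    show "(\<lambda>z. \<eta> z *\<^sub>R calibration \<alpha> k z) \<in> C1c_fields B" by (rule prod(1)[OF 0])
    show "divergence B (\<lambda>z. \<eta> z *\<^sub>R calibration \<alpha> k z) z = (\<Sum>b\<in>Basis. D_calibration \<alpha> k z b \<bullet> b)"
      if "z \<in> K" for z
      using prod(2)[OF 0, of z] that K(2) by (auto simp: \<eta>(7,8))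
  qed (rule \<eta>; assumption)+
qed

text \<open>
  The flux of a single cut-off calibration bounds the flux of all admissible fields supported in \<open>U\<close>.
  The cutoff lives in the half-space rather than in \<open>U\<close>, since it has to be 1 on all of \<open>U\<close>.
\<close>

lemma alpha_cone_caccioppoli:
  assumes m: "2 \<le> CARD('m)" and \<alpha>: "13 \<le> \<alpha>"
  shows "caccioppoli \<alpha> (alpha_cone \<alpha> :: ((real ^ 'm) \<times> real) set) halfspace"
proof -
  let ?E = "alpha_cone \<alpha> :: ((real ^ 'm) \<times> real) set"
  define \<kappa> where "\<kappa> = \<alpha> / (real CARD('m) - 1)"
  have E: "?E = halfspace \<inter> {z. cone_function \<kappa> z \<le> 0}"
    unfolding \<kappa>_def by (rule alpha_cone_eq_sublevel) (use m \<alpha> in auto)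
  have E_borel: "?E \<in> sets borel" using alpha_cone_closed[OF _ m] \<alpha> by simp
  then have E_leb: "?E \<in> sets lebesgue" by simp
  have "indicator ?E \<in> BV \<alpha> U"
    if U: "openin (top_of_set halfspace) U" "compactly_contained U halfspace" for U
  proof -
    have UH: "U \<subseteq> halfspace" using openin_imp_subset[OF U(1)] .
    have K: "compact (closure U)" "closure U \<subseteq> halfspace"
      using U(2) by (auto simp: compactly_contained_def)
    obtain T where "open T" "U = halfspace \<inter> T" using U(1) by (auto simp: openin_open)
    then have U_borel: "U \<in> sets borel"
      by (simp add: sets.Int borel_open borel_closed closed_halfspace)
    have "emeasure lborel (U \<inter> ?E) < \<infinity>"
    proof (rule emeasure_bounded_finite)
      show "bounded (U \<inter> ?E)"
        using bounded_subset[OF compact_imp_bounded[OF K(1)]] closure_subset[of U] by blast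
    qed
    then have "integrable lebesgue (indicator (U \<inter> ?E) :: _ \<Rightarrow> real)"
      using U_borel E_borel by (intro integrable_real_indicator) auto
    then have "set_integrable lebesgue U (indicator ?E :: _ \<Rightarrow> real)"
      by (simp add: set_integrable_def indicator_inter_arith[abs_def])
    moreover have "weighted_variation \<alpha> U (indicator ?E) < \<infinity>"
    proof -
      obtain \<eta> where \<eta>: "(\<lambda>z. \<eta> z *\<^sub>R calibration \<alpha> (\<kappa>\<^sup>2) z) \<in> C1c_fields halfspace"
          "\<And>z. 0 \<le> \<eta> z" "\<And>z. z \<in> closure U \<Longrightarrow> \<eta> z = 1"
        using cutoff_calibration_exists[OF _ openin_halfspace_self K, of \<alpha> "\<kappa>\<^sup>2"] \<alpha> by (smt (verit))
      let ?C = "LINT z:halfspace|lebesgue. indicator ?E z *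
        divergence halfspace (\<lambda>z. \<eta> z *\<^sub>R calibration \<alpha> (\<kappa>\<^sup>2) z) z"
      have "(LINT z:U|lebesgue. indicator ?E z * divergence U \<psi> z) \<le> ?C"
        if \<psi>: "\<psi> \<in> C1c_fields U" "\<forall>z\<in>U. norm (\<psi> z) \<le> snd z powr \<alpha>" for \<psi>
        unfolding integral_zero_extension[OF U(1) \<psi>(1), symmetric]
      proof (rule sublevel_flux_le_calibration_flux[OF _ openin_halfspace_self
            zero_extension_C1c_fields(1)[OF U(1) \<psi>(1)] _ \<eta>(1,2) _ E_leb E])
        show "\<eta> z = 1" if "(if z \<in> U then \<psi> z else 0) \<noteq> 0" for z
          using that \<eta>(3)[of z] closure_subset[of U] by (auto split: if_splits)
      qed (use \<psi>(2) \<alpha> in auto)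
      then have "weighted_variation \<alpha> U (indicator ?E) \<le> ereal ?C"
        unfolding weighted_variation_def by (intro SUP_least) auto
      then show ?thesis using le_less_trans by fastforce
    qed
    ultimately show ?thesis by (simp add: BV_def)
  qed
  then show ?thesis
    using E_leb E by (auto simp: caccioppoli_def BV_loc_def simp del: mem_halfspace)
qed

text \<open>
  The fluxes of the cut-off calibration through the boundaries of \<open>F\<close> and of the cone differ by the
  integral of its divergence over the symmetric difference. There the cutoff is 1, and the divergence is
  nonnegative on the part outside the cone and nonpositive on the part inside it.
\<close>

lemma alpha_cone_perimeter_le:
  fixes B F :: "((real ^ 'm) \<times> real) set"
  assumes m: "2 \<le> CARD('m)" and \<alpha>: "13 \<le> \<alpha>"
    and B: "openin (top_of_set halfspace) B"
    and F: "F \<in> sets lebesgue" "F \<subseteq> halfspace" "compactly_contained (sym_diff F (alpha_cone \<alpha>)) B"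
  shows "perimeter \<alpha> (alpha_cone \<alpha>) B \<le> perimeter \<alpha> F B"
proof -
  let ?E = "alpha_cone \<alpha> :: ((real ^ 'm) \<times> real) set"
  define \<kappa> where "\<kappa> = \<alpha> / (real CARD('m) - 1)"
  have E: "?E = halfspace \<inter> {z. cone_function \<kappa> z \<le> 0}"
    unfolding \<kappa>_def by (rule alpha_cone_eq_sublevel) (use m \<alpha> in auto)
  have \<kappa>: "0 \<le> \<kappa>" using m \<alpha> by (simp add: \<kappa>_def)
  have E_leb: "?E \<in> sets lebesgue" using alpha_cone_closed[OF _ m] \<alpha> by simp
  have BH: "B \<subseteq> halfspace" using openin_imp_subset[OF B] .
  have "ereal (LINT z:B|lebesgue. indicator ?E z * divergence B \<psi> z) \<le> perimeter \<alpha> F B"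
    if \<psi>: "\<psi> \<in> C1c_fields B" "\<forall>z\<in>B. norm (\<psi> z) \<le> snd z powr \<alpha>" for \<psi>
  proof -
    let ?K = "closure {z \<in> B. \<psi> z \<noteq> 0} \<union> closure (sym_diff F ?E)"
    have K: "compact ?K" "?K \<subseteq> B"
      using \<psi>(1) F(3) by (auto simp: C1c_fields_def compactly_contained_def)
    obtain \<eta> where \<eta>: "(\<lambda>z. \<eta> z *\<^sub>R calibration \<alpha> (\<kappa>\<^sup>2) z) \<in> C1c_fields B"
        "\<And>z. 0 \<le> \<eta> z" "\<And>z. \<eta> z \<le> 1" "\<And>z. z \<in> ?K \<Longrightarrow> \<eta> z = 1"
        "\<And>z. z \<in> ?K \<Longrightarrow> divergence B (\<lambda>z. \<eta> z *\<^sub>R calibration \<alpha> (\<kappa>\<^sup>2) z) z =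
          (\<Sum>b\<in>Basis. D_calibration \<alpha> (\<kappa>\<^sup>2) z b \<bullet> b)"
      using cutoff_calibration_exists[OF _ B K, of \<alpha> "\<kappa>\<^sup>2"] \<alpha> by (smt (verit))
    let ?\<phi> = "\<lambda>z. \<eta> z *\<^sub>R calibration \<alpha> (\<kappa>\<^sup>2) z"
    have "(LINT z:B|lebesgue. indicator ?E z * divergence B \<psi> z) \<le>
        (LINT z:B|lebesgue. indicator ?E z * divergence B ?\<phi> z)"
    proof (rule sublevel_flux_le_calibration_flux[OF _ B \<psi>(1) _ \<eta>(1,2) _ E_leb E])
      show "\<eta> z = 1" if "z \<in> B" "\<psi> z \<noteq> 0" for z
        using that \<eta>(4)[of z] closure_subset[of "{z \<in> B. \<psi> z \<noteq> 0}"] by auto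
    qed (use \<psi>(2) \<alpha> in auto)
    also have "\<dots> \<le> (LINT z:B|lebesgue. indicator F z * divergence B ?\<phi> z)"
    proof (rule set_integral_mono)
      show "set_integrable lebesgue B (\<lambda>z. indicator ?E z * divergence B ?\<phi> z)"
        "set_integrable lebesgue B (\<lambda>z. indicator F z * divergence B ?\<phi> z)"
        by (intro indicator_divergence_integrable B \<eta>(1) E_leb F(1))+
      fix z assume z: "z \<in> B"
      show "indicator ?E z * divergence B ?\<phi> z \<le> indicator F z * divergence B ?\<phi> z"
      proof (cases "z \<in> sym_diff F ?E")
        case True
        then have "z \<in> ?K" using closure_subset[of "sym_diff F ?E"] by blast
        have "0 \<le> snd z" using z BH by auto
        obtain c where "0 \<le> c"
          "(\<Sum>b\<in>Basis. D_calibration \<alpha> (\<kappa>\<^sup>2) z b \<bullet> b) = c * ((snd z)\<^sup>2 - \<kappa> * (fst z \<bullet> fst z))"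
          using divergence_calibration_sign[OF m \<alpha> \<open>0 \<le> snd z\<close>, folded \<kappa>_def] by blast
        then have c: "0 \<le> c" "divergence B ?\<phi> z = c * ((snd z)\<^sup>2 - \<kappa> * (fst z \<bullet> fst z))"
          using \<eta>(5)[OF \<open>z \<in> ?K\<close>] by simp_all
        have "z \<in> ?E \<longleftrightarrow> (snd z)\<^sup>2 \<le> \<kappa> * (fst z \<bullet> fst z)"
          using \<open>0 \<le> snd z\<close> by (simp add: E cone_function_sign[OF \<kappa>])
        then show ?thesis
          using True c by (auto simp: mult_nonneg_nonpos)
      qed (auto split: split_indicator)
    qed
    also have "ereal \<dots> \<le> perimeter \<alpha> F B"
      unfolding perimeter_def weighted_variation_def
    proof (rule SUP_upper)
      have "norm (?\<phi> z) \<le> snd z powr \<alpha>" for z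
      proof -
        have "norm (?\<phi> z) \<le> 1 * norm (calibration \<alpha> (\<kappa>\<^sup>2) z)"
          using \<eta>(2,3)[of z] by (simp add: mult_left_le_one_le)
        then show ?thesis using norm_calibration_le[of \<alpha> "\<kappa>\<^sup>2" z] by simp
      qed
      then show "?\<phi> \<in> {\<psi> \<in> C1c_fields B. \<forall>z\<in>B. norm (\<psi> z) \<le> snd z powr \<alpha>}"
        using \<eta>(1) by simp
    qed
    finally show ?thesis by simp
  qed
  then show ?thesis
    unfolding perimeter_def[of _ ?E] weighted_variation_def[of _ _ "indicator ?E"]
    by (intro SUP_least) auto
qed

theorem theorem1p1:
  assumes "CARD('m::finite) \<ge> 2"
  shows "\<exists>\<alpha>\<^sub>m::real. algebraic \<alpha>\<^sub>m \<and> \<alpha>\<^sub>m > 2 / real CARD('m) \<and>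
    (\<forall>\<alpha>\<ge>\<alpha>\<^sub>m. local_perimeter_minimizer \<alpha> (alpha_cone \<alpha> :: ((real ^ 'm) \<times> real) set) halfspace)"
proof (intro exI[of _ 13] conjI allI impI)
  show "algebraic (13 :: real)" by (intro rat_imp_algebraic) simp
  show "2 / real CARD('m) < 13" using assms by (simp add: field_simps)
  show "local_perimeter_minimizer \<alpha> (alpha_cone \<alpha> :: ((real ^ 'm) \<times> real) set) halfspace"
    if "13 \<le> \<alpha>" for \<alpha>
    unfolding local_perimeter_minimizer_def
    using alpha_cone_caccioppoli[OF assms that] alpha_cone_perimeter_le[OF assms that] by blast
qed

end
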